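(* Let $d\ge2$ and let $Q_1,Q_2$ be quadratic forms on $\mathbb{R}^d$. The quadratic surface $\Sigma(Q_1,Q_2)$ is well-curved if and only if the homogeneous polynomial in $s,t$ given by $\det(s\nabla^2Q_1+t\nabla^2Q_2)$ does not vanish identically and does not admit any root of multiplicity larger than $d/2$.
   Context: A root of a homogeneous polynomial in $\mathbb{R}[s,t]$ is a homogeneous linear divisor $as+bt$ in $\mathbb{C}[s,t]$ (with $(a,b)\ne(0,0)$), and its multiplicity is the largest power $m$ such that $(as+bt)^m$ is still a divisor. $\nabla^2 Q_i$ denotes the (constant) Hessian matrix of $Q_i$. Well-curvedness. Let $\phi(\xi)=(\xi,Q_1(\xi),Q_2(\xi))$, $\xi\in[-1,1]^d$, and $\Sigma(Q_1,Q_2)=\phi([-1,1]^d)\subset\mathbb{R}^{d+2}$. The density with respect to $d\xi$ of Gressman's affine invariant surface measure $\nu$ on $\Sigma(Q_1,Q_2)$ is $$\frac{d\nu}{d\xi}=\Big[\inf_{M\in SL(\mathbb{R}^d)}\Big(\sum_{i_1,\dots,i_d,\,j_1,j_2,\,k_1,k_2=1}^d\big|\det\big(X_{i_1}\phi,\dots,X_{i_d}\phi,\;X_{j_1}X_{j_2}\phi,\;X_{k_1}X_{k_2}\phi\big)\big|^2\Big)^{1/2}\Big]^{d/(d+4)},$$ where $X_i=\sum_{k=1}^dM_{ik}\partial_k$. For this $\phi$ it is constant in $\xi$; with $A=\nabla^2Q_1$, $B=\nabla^2Q_2$, it equals a positive dimensional constant times $$\Big[\inf_{M\in SL(\mathbb{R}^d)}\Big(\sum_{j_1,j_2,k_1,k_2=1}^d\big((MAM^\top)_{j_1j_2}(MBM^\top)_{k_1k_2}-(MAM^\top)_{k_1k_2}(MBM^\top)_{j_1j_2}\big)^2\Big)^{1/2}\Big]^{d/(d+4)}.$$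 $\Sigma(Q_1,Q_2)$ is well-curved if this constant is non-zero (and flat if it is zero). *)

theory Defs
  imports "HOL-Analysis.Analysis" "HOL-Computational_Algebra.Polynomial_Factorial"
    "HOL-Computational_Algebra.Field_as_Ring"
begin

definition quadratic_form :: "(real^'n \<Rightarrow> real) \<Rightarrow> bool" where
  "quadratic_form Q \<longleftrightarrow> (\<exists>B. bilinear B \<and> (\<forall>x. Q x = B x x))"

definition partial :: "'n \<Rightarrow> (real^'n \<Rightarrow> 'b::real_normed_vector) \<Rightarrow> real^'n \<Rightarrow> 'b" where
  "partial k f x = frechet_derivative f (at x) (axis k 1)"

definition hessian :: "(real^'n \<Rightarrow> real) \<Rightarrow> real^'n \<Rightarrow> real^'n^'n" where
  "hessian Q x = (\<chi> i j. partial i (partial j Q) x)"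


subsection \<open>The surface and its affine invariant density\<close>

text \<open>
  The index type \<^typ>\<open>'n + 2\<close> serves \<open>\<real>\<^sup>d\<^sup>+\<^sup>2\<close> with \<open>d = CARD('n)\<close>; the two elements of
  the summand \<^typ>\<open>2\<close> are \<open>1\<close> and \<open>2\<close> (the latter being equal to \<open>0\<close>). The map is defined on
  all of \<open>\<real>\<^sup>d\<close>, so that ordinary derivatives are available on the boundary of \<open>[-1,1]\<^sup>d\<close>.
\<close>

definition graph_map ::
    "(real^'n \<Rightarrow> real) \<Rightarrow> (real^'n \<Rightarrow> real) \<Rightarrow> real^'n \<Rightarrow> real^('n + 2)" where
  "graph_map Q1 Q2 \<xi> =
     (\<chi> k. case k of Inl i \<Rightarrow> \<xi> $ i | Inr j \<Rightarrow> if j = 1 then Q1 \<xi> else Q2 \<xi>)"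

definition vfield ::
    "real^'n^'n \<Rightarrow> 'n \<Rightarrow> (real^'n \<Rightarrow> 'b::real_normed_vector) \<Rightarrow> real^'n \<Rightarrow> 'b" where
  "vfield M i f x = (\<Sum>k\<in>UNIV. M $ i $ k *\<^sub>R partial k f x)"

definition frame_det ::
    "real^'n^'n \<Rightarrow> (real^'n \<Rightarrow> real^('n + 2)) \<Rightarrow> real^'n \<Rightarrow>
     ('n \<Rightarrow> 'n) \<Rightarrow> 'n \<Rightarrow> 'n \<Rightarrow> 'n \<Rightarrow> 'n \<Rightarrow> real" where
  "frame_det M \<phi> \<xi> i j1 j2 k1 k2 =
     det (\<chi> r c. (case c of
         Inl l \<Rightarrow> vfield M (i l) \<phi> \<xi>
       | Inr m \<Rightarrow> if m = 1 then vfield M j1 (vfield M j2 \<phi>) \<xi>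
                          else vfield M k1 (vfield M k2 \<phi>) \<xi>) $ r)"

text \<open>The multi-index \<open>(i\<^sub>1, \<dots>, i\<^sub>d)\<close> is a function \<open>i :: 'n \<Rightarrow> 'n\<close>.\<close>

definition affine_density :: "(real^'n \<Rightarrow> real^('n + 2)) \<Rightarrow> real^'n \<Rightarrow> real" where
  "affine_density \<phi> \<xi> =
     (INF M\<in>{M :: real^'n^'n. det M = 1}.
        sqrt (\<Sum>i\<in>(UNIV :: ('n \<Rightarrow> 'n) set).
              \<Sum>j1\<in>UNIV. \<Sum>j2\<in>UNIV. \<Sum>k1\<in>UNIV. \<Sum>k2\<in>UNIV.
                \<bar>frame_det M \<phi> \<xi> i j1 j2 k1 k2\<bar>\<^sup>2))
     powr (real CARD('n) / (real CARD('n) + 4))"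

definition well_curved :: "(real^'n \<Rightarrow> real) \<Rightarrow> (real^'n \<Rightarrow> real) \<Rightarrow> bool" where
  "well_curved Q1 Q2 \<longleftrightarrow>
     (\<exists>c. c \<noteq> 0 \<and> (\<forall>\<xi>. (\<forall>i. \<xi> $ i \<in> {-1..1}) \<longrightarrow> affine_density (graph_map Q1 Q2) \<xi> = c))"


subsection \<open>Binary forms and their roots\<close>

text \<open>
  \<^typ>\<open>'a poly poly\<close> is read as \<open>'a[s][t]\<close>: the variable \<open>s\<close> is the inner one, \<open>t\<close> the outer one.
\<close>

definition linear_form :: "'a::comm_ring_1 \<Rightarrow> 'a \<Rightarrow> 'a poly poly" where
  "linear_form a b = [:[:a:]:] * [:[:0, 1:]:] + [:[:b:]:] * [:0, 1:]"

definition pencil_det :: "real^'n^'n \<Rightarrow> real^'n^'n \<Rightarrow> real poly poly" where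
  "pencil_det A B = det (\<chi> i j. linear_form (A $ i $ j) (B $ i $ j))"

definition complexify :: "real poly poly \<Rightarrow> complex poly poly" where
  "complexify = map_poly (map_poly complex_of_real)"

definition is_root :: "complex \<times> complex \<Rightarrow> real poly poly \<Rightarrow> bool" where
  "is_root r p \<longleftrightarrow> r \<noteq> (0, 0) \<and> linear_form (fst r) (snd r) dvd complexify p"

text \<open>For \<open>p = 0\<close> the library's \<^const>\<open>multiplicity\<close> has the default value \<open>0\<close>.\<close>

definition root_mult :: "complex \<times> complex \<Rightarrow> real poly poly \<Rightarrow> nat" where
  "root_mult r p = multiplicity (linear_form (fst r) (snd r)) (complexify p)"

end

theory Submission
  imports Defs
begin

text \<open>
  Let \<open>A\<close> and \<open>B\<close> be the Hessians and \<open>d\<close> the dimension. The frame determinants of the surface are block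
  triangular, and their squares sum up to a constant times the squared area of the parallelogram
  spanned by \<open>M A M\<^sup>T\<close> and \<open>M B M\<^sup>T\<close> (lemma \<open>affine_density_graph_map\<close>). So the surface is flat if and
  only if this area has infimum zero over all \<open>M\<close> of determinant one, that is, if and only if the vector
  \<open>A \<and> B\<close> is unstable under \<open>SL\<^sub>d\<close>. The theorem says that this instability is detected by the binary
  form \<open>p(s, t) = det (s A + t B)\<close>, which \<open>SL\<^sub>d\<close> leaves invariant: it has to be unstable as a binary form,
  which means that it is zero or has a root of multiplicity larger than \<open>d / 2\<close>. Such a root is
  real up to a scalar, because its complex conjugate has the same multiplicity (lemmas
  \<open>degenerate_imp_unstable\<close> and \<open>unstable_imp_degenerate\<close>).

  If the area is small, a rotation in the plane spanned by the two matrices makes them orthogonal, and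
  rescaling one up and the other down makes both of them small. In the rotated coordinates the
  coefficients of \<open>p\<close> up to index \<open>d / 2\<close> do not decrease under this rescaling, while all coefficients of
  a pair of small matrices are small. As the circle of rotations is compact, these coefficients vanish
  for some rotation, which gives the root (lemma \<open>small_gram_imp_degenerate\<close>).

  Conversely, let \<open>p\<close> be unstable and suppose that the area stays away from zero. A minimizing sequence,
  written in orthogonal bases with equal norms, converges to a pair \<open>(A, B)\<close> that minimizes the area in
  its own orbit and whose form is still unstable; a rotation puts the root at \<open>B\<close>. The first variation
  shows that \<open>A\<^sup>2 + B\<^sup>2 = c\<close> with \<open>c > 0\<close> (lemma \<open>gram_minimum_scalar\<close>). Therefore \<open>A\<close> preserves the
  kernel of \<open>B\<close> and \<open>A\<^sup>2 = c\<close> there, so that \<open>det (B + x A)\<close> vanishes at \<open>x = 0\<close> exactly to the order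
  \<open>k = dim ker B\<close>. As \<open>A\<close> and \<open>B\<close> have equal norms, \<open>c k \<le> tr A\<^sup>2 = c d / 2\<close>, which contradicts the
  multiplicity of the root (lemmas \<open>adapted_coefficient\<close> and \<open>degenerate_imp_small_gram\<close>).
\<close>

section \<open>The determinant of a pencil along a line\<close>

text \<open>
  The binary form \<open>det (s X + t Y)\<close> restricted to the affine line \<open>s = 1\<close>. By homogeneity its
  coefficients determine the form, so all of the work with binary forms can be done in one variable.
\<close>

definition line_det :: "real^'n^'n \<Rightarrow> real^'n^'n \<Rightarrow> real poly" where
  "line_det X Y = det (\<chi> i j. [:X $ i $ j, Y $ i $ j:])"

text \<open>
  The squared area of the parallelogram spanned by \<open>x\<close> and \<open>y\<close>. For two matrices with the Frobenius
  inner product this is the squared norm of \<open>X \<and> Y\<close>, half of the sum of squares in the density.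
\<close>

definition gram :: "'a::real_inner \<Rightarrow> 'a \<Rightarrow> real" where
  "gram x y = (x \<bullet> x) * (y \<bullet> y) - (x \<bullet> y)\<^sup>2"

definition congr :: "real^'n^'n \<Rightarrow> real^'n^'n \<Rightarrow> real^'n^'n" where
  "congr M A = M ** A ** transpose M"

lemma coeff_mult_tendsto:
  fixes p q :: "'k \<Rightarrow> real poly"
  assumes "\<And>j. ((\<lambda>k. coeff (p k) j) \<longlongrightarrow> coeff p' j) F"
    and "\<And>j. ((\<lambda>k. coeff (q k) j) \<longlongrightarrow> coeff q' j) F"
  shows "((\<lambda>k. coeff (p k * q k) j) \<longlongrightarrow> coeff (p' * q') j) F"
  unfolding coeff_mult by (intro tendsto_intros assms)

lemma coeff_prod_tendsto:
  fixes p :: "'i \<Rightarrow> 'k \<Rightarrow> real poly"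
  assumes "\<And>i j. i \<in> I \<Longrightarrow> ((\<lambda>k. coeff (p i k) j) \<longlongrightarrow> coeff (p' i) j) F"
  shows "((\<lambda>k. coeff (\<Prod>i\<in>I. p i k) j) \<longlongrightarrow> coeff (\<Prod>i\<in>I. p' i) j) F"
  using assms
proof (induction I arbitrary: j rule: infinite_finite_induct)
  case (insert x I)
  then show ?case by (simp add: coeff_mult_tendsto)
qed auto

text \<open>
  The compactness arguments below pass to limits of matrices and need the vanishing of coefficients
  to survive; it does, because each coefficient is a polynomial in the matrix entries.
\<close>

lemma coeff_line_det_tendsto:
  fixes X Y :: "'k \<Rightarrow> real^'n^'n"
  assumes X: "(X \<longlongrightarrow> X') F" and Y: "(Y \<longlongrightarrow> Y') F"
  shows "((\<lambda>k. coeff (line_det (X k) (Y k)) j) \<longlongrightarrow> coeff (line_det X' Y') j) F"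
proof -
  have ent: "((\<lambda>k. coeff [:X k $ a $ b, Y k $ a $ b:] j) \<longlongrightarrow> coeff [:X' $ a $ b, Y' $ a $ b:] j) F"
    for a b j
    using X Y by (auto simp: coeff_pCons split: nat.split intro!: tendsto_intros)
  have "((\<lambda>k. coeff (of_int s * (\<Prod>i\<in>UNIV. [:X k $ i $ p i, Y k $ i $ p i:])) j) \<longlongrightarrow>
      coeff (of_int s * (\<Prod>i\<in>UNIV. [:X' $ i $ p i, Y' $ i $ p i:])) j) F" for s :: int and p
    by (intro coeff_mult_tendsto coeff_prod_tendsto ent tendsto_const)
  then show ?thesis
    unfolding line_det_def det_def by (simp add: coeff_sum tendsto_sum)
qed

section \<open>Homogenization and substitution\<close>

text \<open>
  Determinants commute with ring homomorphisms. This moves determinants between real and complex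
  coefficients, between one and two variables, and from polynomials to their values.
\<close>

locale comm_ring_map =
  fixes h :: "'a::comm_ring_1 \<Rightarrow> 'b::comm_ring_1"
  assumes add: "h (x + y) = h x + h y" and mult: "h (x * y) = h x * h y" and one: "h 1 = 1"
begin

lemma zero: "h 0 = 0" using add[of 0 0] by simp

lemma uminus: "h (- x) = - h x"
  using add[of x "-x"] by (simp add: zero eq_neg_iff_add_eq_0 add.commute)

lemma sum: "h (\<Sum>i\<in>I. f i) = (\<Sum>i\<in>I. h (f i))"
  by (induction I rule: infinite_finite_induct) (auto simp: zero add)

lemma prod: "h (\<Prod>i\<in>I. f i) = (\<Prod>i\<in>I. h (f i))"
  by (induction I rule: infinite_finite_induct) (auto simp: one mult)

lemma power: "h (x ^ n) = h x ^ n"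
  by (induction n) (auto simp: one mult)

lemma dvd: "x dvd y \<Longrightarrow> h x dvd h y"
  by (auto simp: dvd_def mult)

lemma of_int_sign: "h (of_int (sign p)) = of_int (sign p)"
  by (simp add: sign_def one uminus)

lemma det: "h (det M) = det (\<chi> i j. h (M $ i $ j))"
  by (simp add: det_def sum mult prod of_int_sign)

lemma map_poly_comm_ring_map: "comm_ring_map (map_poly h)"
proof
  fix p q :: "'a poly"
  show "map_poly h (p + q) = map_poly h p + map_poly h q"
    by (rule poly_eqI) (simp add: coeff_map_poly zero add)
  show "map_poly h (p * q) = map_poly h p * map_poly h q"
    by (rule poly_eqI) (simp add: coeff_map_poly zero sum mult coeff_mult)
  show "map_poly h 1 = 1" by (simp add: one)
qed

end

lemma comm_ring_map_comp: "comm_ring_map f \<Longrightarrow> comm_ring_map g \<Longrightarrow> comm_ring_map (\<lambda>x. f (g x))"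
  by (simp add: comm_ring_map_def)

lemma comm_ring_map_of_real: "comm_ring_map complex_of_real"
  by unfold_locales auto

lemma comm_ring_map_const: "comm_ring_map (\<lambda>c. [:c:])"
  by unfold_locales (auto simp: one_pCons)

lemma comm_ring_map_poly: "comm_ring_map (\<lambda>p. poly p x)"
  by unfold_locales auto

lemma comm_ring_map_pcompose: "comm_ring_map (\<lambda>p. pcompose p x)"
  by unfold_locales (auto simp: pcompose_add pcompose_mult pcompose_1)

lemma comm_ring_map_complexify: "comm_ring_map complexify"
  unfolding complexify_def
  by (intro comm_ring_map.map_poly_comm_ring_map comm_ring_map_of_real)

text \<open>
  The homomorphism \<open>s \<mapsto> S\<close>, \<open>t \<mapsto> T\<close> into polynomials in one variable. With linear \<open>S\<close> and \<open>T\<close> it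
  restricts a binary form to a line.
\<close>

definition subst_st :: "'a::comm_ring_1 poly \<Rightarrow> 'a poly \<Rightarrow> 'a poly poly \<Rightarrow> 'a poly" where
  "subst_st S T P = poly (map_poly (\<lambda>c. pcompose c S) P) T"

lemma comm_ring_map_subst_st: "comm_ring_map (subst_st S T)"
  unfolding subst_st_def
  by (intro comm_ring_map_comp[OF comm_ring_map_poly] comm_ring_map.map_poly_comm_ring_map
      comm_ring_map_pcompose)

lemma linear_form_altdef: "linear_form a b = [:[:0, a:], [:b:]:]"
  by (simp add: linear_form_def)

lemma subst_st_linear_form: "subst_st S T (linear_form a b) = smult a S + smult b T"
  by (simp add: subst_st_def linear_form_altdef map_poly_pCons pcompose_pCons algebra_simps)

lemma complexify_linear_form:
  "complexify (linear_form a b) = linear_form (complex_of_real a) (complex_of_real b)"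
  by (simp add: complexify_def linear_form_altdef map_poly_pCons)

lemma complexify_pencil_det:
  "complexify (pencil_det A B) =
     det (\<chi> i j. linear_form (complex_of_real (A $ i $ j)) (complex_of_real (B $ i $ j)))"
  by (simp add: pencil_det_def comm_ring_map.det[OF comm_ring_map_complexify] complexify_linear_form)

lemma subst_st_complexify_pencil_det:
  "subst_st [:of_real a, of_real a':] [:of_real b, of_real b':] (complexify (pencil_det A B)) =
     map_poly complex_of_real (line_det (a *\<^sub>R A + b *\<^sub>R B) (a' *\<^sub>R A + b' *\<^sub>R B))"
proof -
  have "map_poly complex_of_real (line_det (a *\<^sub>R A + b *\<^sub>R B) (a' *\<^sub>R A + b' *\<^sub>R B)) =
      det (\<chi> i j. map_poly complex_of_real
        [:a * A $ i $ j + b * B $ i $ j, a' * A $ i $ j + b' * B $ i $ j:])"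
    unfolding line_det_def
    by (subst comm_ring_map.det[OF comm_ring_map.map_poly_comm_ring_map[OF comm_ring_map_of_real]]) simp
  then show ?thesis
    by (simp add: complexify_pencil_det comm_ring_map.det[OF comm_ring_map_subst_st]
        subst_st_linear_form map_poly_pCons mult.commute)
qed

text \<open>
  Each factor \<open>x\<^sub>i + y\<^sub>i X\<close> becomes \<open>x\<^sub>i al + y\<^sub>i be\<close>, so the coefficient of \<open>X\<^sup>j\<close> is accompanied by
  \<open>be\<^sup>j\<close> and by one factor \<open>al\<close> for each of the remaining indices.
\<close>

lemma prod_linear_homogenize:
  fixes al be :: "'a::comm_ring_1"
  assumes h: "comm_ring_map h" and "finite I"
  shows "(\<Prod>i\<in>I. h (x i) * al + h (y i) * be) =
     (\<Sum>j\<le>card I. h (coeff (\<Prod>i\<in>I. [:x i, y i:]) j) * al ^ (card I - j) * be ^ j)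
     \<and> degree (\<Prod>i\<in>I. [:x i, y i:]) \<le> card I"
  using \<open>finite I\<close>
proof (induction I rule: finite_induct)
  case empty
  interpret comm_ring_map h by (rule h)
  show ?case by (simp add: one)
next
  case (insert k I)
  interpret comm_ring_map h by (rule h)
  define n where "n = card I"
  define p where "p = (\<Prod>i\<in>I. [:x i, y i:])"
  have deg: "degree p \<le> n" using insert by (simp add: p_def n_def)
  then have top: "coeff p (Suc n) = 0" by (simp add: coeff_eq_0)
  have IH: "(\<Prod>i\<in>I. h (x i) * al + h (y i) * be) = (\<Sum>j\<le>n. h (coeff p j) * al ^ (n - j) * be ^ j)"
    using insert by (simp add: p_def n_def)
  have "(\<Sum>j\<le>Suc n. h (coeff ([:x k, y k:] * p) j) * al ^ (Suc n - j) * be ^ j) =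
     (\<Sum>j\<le>Suc n. h (x k) * h (coeff p j) * al ^ (Suc n - j) * be ^ j) +
     (\<Sum>j\<le>Suc n. (case j of 0 \<Rightarrow> 0 | Suc i \<Rightarrow> h (y k) * h (coeff p i)) * al ^ (Suc n - j) * be ^ j)"
    unfolding sum.distrib[symmetric]
    by (rule sum.cong) (auto simp: coeff_pCons add mult zero algebra_simps split: nat.split)
  also have "(\<Sum>j\<le>Suc n. h (x k) * h (coeff p j) * al ^ (Suc n - j) * be ^ j) =
      h (x k) * al * (\<Sum>j\<le>n. h (coeff p j) * al ^ (n - j) * be ^ j)"
    by (simp add: top zero sum_distrib_left Suc_diff_le algebra_simps)
  also have "(\<Sum>j\<le>Suc n. (case j of 0 \<Rightarrow> 0 | Suc i \<Rightarrow> h (y k) * h (coeff p i)) * al ^ (Suc n - j) * be ^ j)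
      = h (y k) * be * (\<Sum>j\<le>n. h (coeff p j) * al ^ (n - j) * be ^ j)"
    by (simp add: sum.atMost_Suc_shift sum_distrib_left algebra_simps del: sum.atMost_Suc)
  finally have eq: "(\<Sum>j\<le>Suc n. h (coeff ([:x k, y k:] * p) j) * al ^ (Suc n - j) * be ^ j) =
      (h (x k) * al + h (y k) * be) * (\<Sum>j\<le>n. h (coeff p j) * al ^ (n - j) * be ^ j)"
    by (simp add: algebra_simps)
  have "degree ([:x k, y k:] * p) \<le> Suc n"
    using degree_mult_le[of "[:x k, y k:]" p] deg by (auto split: if_splits)
  then show ?case
    using insert.hyps eq IH by (simp add: p_def n_def del: mult_pCons_left sum.atMost_Suc)
qed

text \<open>
  Leibniz expansion reduces this to products of linear factors. It recovers the binary form from its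
  restriction to a line.
\<close>

lemma det_homogenize:
  fixes al be :: "'a::comm_ring_1" and X Y :: "real^'n^'n"
  assumes h: "comm_ring_map h"
  shows "det (\<chi> i j. h (X $ i $ j) * al + h (Y $ i $ j) * be) =
     (\<Sum>j\<le>CARD('n). h (coeff (line_det X Y) j) * al ^ (CARD('n) - j) * be ^ j)"
proof -
  interpret comm_ring_map h by (rule h)
  have sg: "coeff (of_int (sign p) * q) j = of_int (sign p) * coeff q j" for p :: "'n \<Rightarrow> 'n" and q :: "real poly" and j
    by (simp add: sign_def)
  have "det (\<chi> i j. h (X $ i $ j) * al + h (Y $ i $ j) * be) =
    (\<Sum>p | p permutes UNIV. of_int (sign p) *
       (\<Sum>j\<le>CARD('n). h (coeff (\<Prod>i\<in>UNIV. [:X $ i $ p i, Y $ i $ p i:]) j) * al ^ (CARD('n) - j) * be ^ j))"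
    unfolding det_def by (simp add: conjunct1[OF prod_linear_homogenize[OF h]])
  also have "\<dots> = (\<Sum>j\<le>CARD('n). \<Sum>p | p permutes UNIV. of_int (sign p) *
       (h (coeff (\<Prod>i\<in>UNIV. [:X $ i $ p i, Y $ i $ p i:]) j) * al ^ (CARD('n) - j) * be ^ j))"
    unfolding sum_distrib_left by (rule sum.swap)
  also have "\<dots> = (\<Sum>j\<le>CARD('n). h (coeff (line_det X Y) j) * al ^ (CARD('n) - j) * be ^ j)"
    unfolding line_det_def det_def
    by (simp add: coeff_sum sum mult of_int_sign sg sum_distrib_right mult.assoc)
  finally show ?thesis .
qed

lemma degree_line_det_le: "degree (line_det X Y) \<le> CARD('n)" for X Y :: "real^'n^'n"
proof -
  have "degree (of_int (sign p) * (\<Prod>i\<in>UNIV. [:X $ i $ p i, Y $ i $ p i:])) \<le> CARD('n)" for p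
    using conjunct2[OF prod_linear_homogenize[OF comm_ring_map_of_real, of "UNIV::'n set"
          "\<lambda>i. X $ i $ p i" _ "\<lambda>i. Y $ i $ p i"]]
    by (simp add: sign_def)
  then show ?thesis unfolding line_det_def det_def by (auto intro!: degree_sum_le)
qed

text \<open>
  The torus \<open>(X, Y) \<mapsto> (l X, Y / l)\<close> acts on the coefficient of index \<open>j\<close> with weight \<open>d - 2 j\<close>. This is
  where the bound \<open>d / 2\<close> on the multiplicities comes from: the weight is non-negative exactly for
  \<open>j \<le> d / 2\<close>.
\<close>

lemma line_det_scale:
  fixes X Y :: "real^'n^'n"
  assumes l: "l \<noteq> 0"
  shows "coeff (line_det (l *\<^sub>R X) (inverse l *\<^sub>R Y)) j = l ^ CARD('n) * (inverse l ^ 2) ^ j * coeff (line_det X Y) j"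
proof -
  let ?c = "\<lambda>p. pcompose p [:0, inverse l ^ 2:]"
  have "line_det (l *\<^sub>R X) (inverse l *\<^sub>R Y) =
      det (\<chi> i. [:l:] *s (\<chi> j. ?c [:X $ i $ j, Y $ i $ j:]))"
    unfolding line_det_def using l
    by (intro arg_cong[where f = det]) (simp add: vec_eq_iff pcompose_pCons power2_eq_square field_simps)
  also have "\<dots> = [:l:] ^ CARD('n) * det (\<chi> i j. ?c [:X $ i $ j, Y $ i $ j:])"
    by (subst det_rows_mul) simp
  also have "det (\<chi> i j. ?c [:X $ i $ j, Y $ i $ j:]) = ?c (line_det X Y)"
    unfolding line_det_def by (subst comm_ring_map.det[OF comm_ring_map_pcompose]) simp
  also have "[:l:] ^ CARD('n) = [:l ^ CARD('n):]"
    by (simp add: comm_ring_map.power[OF comm_ring_map_const, symmetric])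
  finally show ?thesis by (simp add: coeff_pcompose_linear)
qed

lemma line_det_congr:
  fixes X Y M :: "real^'n^'n"
  shows "line_det (congr M X) (congr M Y) = smult ((det M)\<^sup>2) (line_det X Y)"
proof -
  let ?C = "\<lambda>M. (\<chi> i j. [:M $ i $ j:]) :: real poly^'n^'n"
  let ?P = "\<lambda>X Y. (\<chi> i j. [:X $ i $ j, Y $ i $ j:]) :: real poly^'n^'n"
  have C: "det (?C M) = [:det M:]" for M
    by (simp add: comm_ring_map.det[OF comm_ring_map_const, symmetric])
  have const_sum: "(\<Sum>i\<in>I. [:f i, g i:]) = [:sum f I, sum g I :: real:]" for I :: "'n set" and f g
    by (induction I rule: infinite_finite_induct) auto
  have 1: "?P (M ** X) (M ** Y) = ?C M ** ?P X Y" for M X Y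
    unfolding matrix_matrix_mult_def by (simp add: vec_eq_iff const_sum, simp add: mult.commute)
  have 2: "?P (X ** M) (Y ** M) = ?P X Y ** ?C M" for M X Y
    by (simp add: matrix_matrix_mult_def vec_eq_iff const_sum mult.commute)
  show ?thesis
    unfolding line_det_def congr_def 2 1 det_mul C by (simp add: power2_eq_square)
qed

lemma complexify_eq_0_iff: "complexify P = 0 \<longleftrightarrow> P = 0"
proof -
  have "map_poly complex_of_real p = 0 \<longleftrightarrow> p = 0" for p
    by (simp add: poly_eq_iff coeff_map_poly)
  then show ?thesis
    by (simp add: complexify_def poly_eq_iff[of "map_poly _ P"] poly_eq_iff[of P] coeff_map_poly)
qed

lemma linear_form_not_unit:
  assumes "(u, v) \<noteq> (0, 0 :: complex)"
  shows "\<not> is_unit (linear_form u v)"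
proof
  assume "is_unit (linear_form u v)"
  then have "subst_st [:v:] [:-u:] (linear_form u v) dvd subst_st [:v:] [:-u:] 1"
    by (rule comm_ring_map.dvd[OF comm_ring_map_subst_st])
  then show False
    by (simp add: subst_st_linear_form comm_ring_map.one[OF comm_ring_map_subst_st])
qed

text \<open>
  The form in the rotated coordinates \<open>a s + b t\<close> and \<open>- b s + a t\<close>. If its first \<open>m\<close> coefficients
  vanish, then \<open>(- b s + a t)\<^sup>m\<close> is a factor.
\<close>

lemma pencil_det_expand:
  fixes A B :: "real^'n^'n"
  assumes "a\<^sup>2 + b\<^sup>2 = 1"
  shows "pencil_det A B = (\<Sum>j\<le>CARD('n). [:[:coeff (line_det (a *\<^sub>R A + b *\<^sub>R B) (- b *\<^sub>R A + a *\<^sub>R B)) j:]:]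
    * linear_form a b ^ (CARD('n) - j) * linear_form (- b) a ^ j)"
proof -
  have h: "comm_ring_map (\<lambda>c :: real. [:[:c:]:])"
    by (intro comm_ring_map_comp[OF comm_ring_map_const] comm_ring_map_const)
  have a: "a * a = 1 - b * b" using assms by (simp add: power2_eq_square)
  have "(a * x + b * y) * a + (- b * x + a * y) * - b = x"
    "(a * x + b * y) * b + (- b * x + a * y) * a = y" for x y
    using a by algebra+
  then have lin: "linear_form x y = [:[:a * x + b * y:]:] * linear_form a b + [:[:- b * x + a * y:]:] * linear_form (- b) a" for x y
    by (simp add: linear_form_altdef)
  have "pencil_det A B = det (\<chi> i j. [:[:(a *\<^sub>R A + b *\<^sub>R B) $ i $ j:]:] * linear_form a b
      + [:[:(- b *\<^sub>R A + a *\<^sub>R B) $ i $ j:]:] * linear_form (- b) a)"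
    unfolding pencil_det_def
  proof (intro arg_cong[where f = det] arg_cong[where f = vec_lambda] ext)
    fix i j
    have "(a *\<^sub>R A + b *\<^sub>R B) $ i $ j = a * A $ i $ j + b * B $ i $ j"
      "(- b *\<^sub>R A + a *\<^sub>R B) $ i $ j = - b * A $ i $ j + a * B $ i $ j" by simp_all
    note c = this
    show "linear_form (A $ i $ j) (B $ i $ j) = [:[:(a *\<^sub>R A + b *\<^sub>R B) $ i $ j:]:] * linear_form a b
      + [:[:(- b *\<^sub>R A + a *\<^sub>R B) $ i $ j:]:] * linear_form (- b) a"
      unfolding c by (rule lin)
  qed
  then show ?thesis unfolding det_homogenize[OF h] .
qed

section \<open>Multiplicities of roots\<close>

text \<open>
  The form \<open>det (s A + t B)\<close> vanishes at the point \<open>(a, b)\<close> to order larger than \<open>d / 2\<close> along the line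
  through \<open>(a, b)\<close> with direction \<open>(a', b')\<close>. The zero form is included, which lets the case of a
  vanishing determinant be treated together with that of a root of high multiplicity.
\<close>

definition degenerate_at :: "real^'n^'n \<Rightarrow> real^'n^'n \<Rightarrow> real \<Rightarrow> real \<Rightarrow> real \<Rightarrow> real \<Rightarrow> bool" where
  "degenerate_at A B a b a' b' \<longleftrightarrow>
    (\<forall>j \<le> CARD('n) div 2. coeff (line_det (a *\<^sub>R A + b *\<^sub>R B) (a' *\<^sub>R A + b' *\<^sub>R B)) j = 0)"

definition unstable_pencil :: "real^'n^'n \<Rightarrow> real^'n^'n \<Rightarrow> bool" where
  "unstable_pencil A B \<longleftrightarrow> pencil_det A B = 0 \<or>
     (\<exists>r. is_root r (pencil_det A B) \<and> real (root_mult r (pencil_det A B)) > real CARD('n) / 2)"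

text \<open>
  One direction transversal to the line \<open>\<real> (a, b)\<close> suffices, since homogeneity turns the vanishing of
  low coefficients into a power of a linear form.
\<close>

lemma degenerate_imp_unstable:
  fixes A B :: "real^'n^'n"
  assumes ab: "a\<^sup>2 + b\<^sup>2 = 1" and deg: "degenerate_at A B a b (- b) a"
  shows "unstable_pencil A B"
proof (cases "pencil_det A B = 0")
  case False
  define m where "m = CARD('n) div 2 + 1"
  define L where "L = linear_form (- b) a"
  define r where "r = (complex_of_real (- b), complex_of_real a)"
  have "L ^ m dvd pencil_det A B"
    unfolding pencil_det_expand[OF ab]
  proof (rule dvd_sum)
    fix j
    show "L ^ m dvd [:[:coeff (line_det (a *\<^sub>R A + b *\<^sub>R B) (- b *\<^sub>R A + a *\<^sub>R B)) j:]:]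
      * linear_form a b ^ (CARD('n) - j) * linear_form (- b) a ^ j"
    proof (cases "j < m")
      case True
      then have "coeff (line_det (a *\<^sub>R A + b *\<^sub>R B) (- b *\<^sub>R A + a *\<^sub>R B)) j = 0"
        using deg by (simp add: degenerate_at_def m_def)
      then show ?thesis by simp
    next
      case False
      then show ?thesis by (simp add: L_def dvd_mult dvd_smult le_imp_power_dvd)
    qed
  qed
  then have "complexify (L ^ m) dvd complexify (pencil_det A B)"
    by (rule comm_ring_map.dvd[OF comm_ring_map_complexify])
  then have dvd: "linear_form (fst r) (snd r) ^ m dvd complexify (pencil_det A B)"
    by (simp add: comm_ring_map.power[OF comm_ring_map_complexify] L_def complexify_linear_form r_def)
  have r: "r \<noteq> (0, 0)" using ab by (auto simp: r_def)
  then have "\<not> is_unit (linear_form (fst r) (snd r))"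
    using linear_form_not_unit[of "fst r" "snd r"] by simp
  then have "root_mult r (pencil_det A B) \<ge> m"
    unfolding root_mult_def using dvd False by (intro multiplicity_geI) (auto simp: complexify_eq_0_iff)
  moreover have "is_root r (pencil_det A B)"
    using r dvd dvd_trans[OF dvd_power[of m]] by (auto simp: is_root_def m_def)
  ultimately show ?thesis
    unfolding unstable_pencil_def by (intro disjI2 exI[of _ r]) (auto simp: m_def)
qed (simp add: unstable_pencil_def)

lemma coeff_eq_0_if_power_dvd:
  assumes "[:0, e:] ^ m dvd (p :: 'a::comm_ring_1 poly)" "j < m"
  shows "coeff p j = 0"
proof -
  from assms(1) obtain q where "p = [:0, e:] ^ m * q" by (auto simp: dvd_def)
  moreover have "[:0, e:] = smult e (monom 1 1)" by (simp add: monom_altdef)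
  ultimately have "p = smult (e ^ m) (monom 1 m * q)" by (simp add: smult_power monom_power)
  then show ?thesis using assms(2) by (simp add: coeff_monom_mult)
qed

text \<open>
  A root of multiplicity larger than \<open>d / 2\<close> is real up to a scalar: otherwise its complex conjugate
  would be a different root with the same multiplicity, and both together exceed the degree.
\<close>

lemma unstable_imp_degenerate:
  fixes A B :: "real^'n^'n"
  assumes "unstable_pencil A B"
  shows "\<exists>a b. a\<^sup>2 + b\<^sup>2 = 1 \<and> (\<forall>a' b'. degenerate_at A B a b a' b')"
proof (cases "pencil_det A B = 0")
  case True
  then have "map_poly complex_of_real (line_det (1 *\<^sub>R A + 0 *\<^sub>R B) (a' *\<^sub>R A + b' *\<^sub>R B)) = 0" for a' b'
    unfolding subst_st_complexify_pencil_det[symmetric]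
    by (simp add: comm_ring_map.zero[OF comm_ring_map_complexify] comm_ring_map.zero[OF comm_ring_map_subst_st])
  then have "line_det (1 *\<^sub>R A + 0 *\<^sub>R B) (a' *\<^sub>R A + b' *\<^sub>R B) = 0" for a' b'
    by (simp add: map_poly_eq_0_iff)
  then show ?thesis
    by (intro exI[of _ 1] exI[of _ 0]) (simp add: degenerate_at_def)
next
  case False
  define m where "m = CARD('n) div 2 + 1"
  from assms False obtain u v where uv: "(u, v) \<noteq> (0, 0)"
    and "real (root_mult (u, v) (pencil_det A B)) > real CARD('n) / 2"
    by (auto simp: unstable_pencil_def is_root_def)
  then have "m \<le> multiplicity (linear_form u v) (complexify (pencil_det A B))"
    by (auto simp: root_mult_def m_def)
  then have dvd: "linear_form u v ^ m dvd complexify (pencil_det A B)"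
    by (rule multiplicity_dvd')
  have dvd': "(smult u [:of_real a, of_real a':] + smult v [:of_real b, of_real b':]) ^ m
      dvd map_poly complex_of_real (line_det (a *\<^sub>R A + b *\<^sub>R B) (a' *\<^sub>R A + b' *\<^sub>R B))" for a b a' b'
    using comm_ring_map.dvd[OF comm_ring_map_subst_st dvd,
        of "[:of_real a, of_real a':]" "[:of_real b, of_real b':]"]
    unfolding comm_ring_map.power[OF comm_ring_map_subst_st] subst_st_linear_form
      subst_st_complexify_pencil_det .
  (* A real zero (a, b) of the linear form: on a line through (a, b) the linear form becomes a
     multiple of the variable, so the m-th power kills the first m coefficients. *)
  have real: ?thesis if ab: "a\<^sup>2 + b\<^sup>2 = 1" "u * of_real a + v * of_real b = 0" for a b :: real
  proof (intro exI conjI allI)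
    fix a' b'
    have "smult u [:of_real a, of_real a':] + smult v [:of_real b, of_real b':] = [:0, u * of_real a' + v * of_real b':]"
      using ab by simp
    then have "coeff (map_poly complex_of_real (line_det (a *\<^sub>R A + b *\<^sub>R B) (a' *\<^sub>R A + b' *\<^sub>R B))) j = 0" if "j < m" for j
      using coeff_eq_0_if_power_dvd[OF _ that] dvd'[of a a' b b'] by simp
    then show "degenerate_at A B a b a' b'"
      by (simp add: degenerate_at_def m_def coeff_map_poly)
  qed (rule ab)
  show ?thesis
  proof (cases "v = 0")
    case True
    then show ?thesis using real[of 0 1] by simp
  next
    case v: False
    show ?thesis
    proof (cases "u / v \<in> \<real>")
      case True
      then obtain w where w: "u = of_real w * v" using v by (auto elim!: Reals_cases simp: field_simps)
      define n where "n = sqrt (1 + w\<^sup>2)"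
      have pos: "1 + w\<^sup>2 > 0" by (simp add: add_pos_nonneg)
      then have n: "n \<noteq> 0" "n\<^sup>2 = 1 + w\<^sup>2" by (simp_all add: n_def)
      show ?thesis
      proof (rule real[of "1 / n" "- w / n"])
        show "(1 / n)\<^sup>2 + (- w / n)\<^sup>2 = 1"
          using n pos by (simp add: power_divide add_divide_distrib[symmetric])
        show "u * of_real (1 / n) + v * of_real (- w / n) = 0"
          by (simp add: w)
      qed
    next
      case nonreal: False
      then have u: "u \<noteq> 0" by auto
      (* Restricted to the line t = 1, with s running through - x, the linear form has the single
         root z = v / u. *)
      define z where "z = v / u"
      define f where "f = map_poly complex_of_real (line_det (0 *\<^sub>R A + 1 *\<^sub>R B) (- 1 *\<^sub>R A + 0 *\<^sub>R B))"
      have "z \<noteq> cnj z"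
      proof
        assume "z = cnj z"
        then have "inverse z \<in> \<real>" by (metis Reals_cnj_iff Reals_inverse)
        then show False using nonreal by (simp add: z_def)
      qed
      have "smult u [:0, - 1:] + smult v [:1, 0:] = smult (- u) [:- z, 1:]"
        using u by (simp add: z_def)
      then have "(smult (- u) [:- z, 1:]) ^ m dvd f"
        using dvd'[of 0 "-1" 1 0] by (simp only: f_def of_real_0 of_real_1 of_real_minus)
      then have d1: "[:- z, 1:] ^ m dvd f"
        using u unfolding smult_power smult_dvd_iff by simp
      have cnj: "comm_ring_map cnj" by unfold_locales auto
      have "map_poly cnj ([:- z, 1:] ^ m) dvd map_poly cnj f"
        by (rule comm_ring_map.dvd[OF comm_ring_map.map_poly_comm_ring_map[OF cnj] d1])
      moreover have "map_poly cnj f = f"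
        by (rule poly_eqI) (simp add: f_def coeff_map_poly)
      moreover have "map_poly cnj ([:- z, 1:] ^ m) = [:- cnj z, 1:] ^ m"
        unfolding comm_ring_map.power[OF comm_ring_map.map_poly_comm_ring_map[OF cnj]]
        by (simp add: map_poly_pCons)
      ultimately have d2: "[:- cnj z, 1:] ^ m dvd f" by simp
      have "coprime [:- z, 1:] [:- cnj z, 1:]"
      proof (rule coprimeI)
        fix c :: "complex poly"
        assume "c dvd [:- z, 1:]" "c dvd [:- cnj z, 1:]"
        then have "c dvd [:- cnj z, 1:] - [:- z, 1:]" by (simp only: dvd_diff)
        then have "c dvd [:z - cnj z:]" by simp
        moreover have "is_unit [:z - cnj z:]"
          using \<open>z \<noteq> cnj z\<close> by (simp add: is_unit_const_poly_iff dvd_field_iff)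
        ultimately show "is_unit c" by (rule dvd_unit_imp_unit)
      qed
      then have "coprime ([:- z, 1:] ^ m) ([:- cnj z, 1:] ^ m)"
        by (simp only: coprime_power_left_iff coprime_power_right_iff simp_thms)
      then have "[:- z, 1:] ^ m * [:- cnj z, 1:] ^ m dvd f"
        by (rule divides_mult[OF d1 d2])
      moreover have "f \<noteq> 0"
      proof
        assume "f = 0"
        then have "line_det (0 *\<^sub>R A + 1 *\<^sub>R B) (- 1 *\<^sub>R A + 0 *\<^sub>R B) = 0"
          unfolding f_def by (subst (asm) map_poly_eq_0_iff) auto
        then show False using pencil_det_expand[of 0 1 A B] False by simp
      qed
      ultimately have "degree ([:- z, 1:] ^ m * [:- cnj z, 1:] ^ m) \<le> degree f"
        by (rule dvd_imp_degree_le)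
      also have "\<dots> \<le> CARD('n)"
        using degree_line_det_le by (simp add: f_def degree_map_poly del: scaleR_zero_left scaleR_one)
      also have "degree ([:- z, 1:] ^ m * [:- cnj z, 1:] ^ m) = m + m"
        by (subst degree_mult_eq) (simp_all only: degree_linear_power, auto)
      finally have False unfolding m_def by linarith
      then show ?thesis ..
    qed
  qed
qed

section \<open>Small areas force a root of high multiplicity\<close>

text \<open>
  A quarter turn of the pair changes the sign of the inner product, so some rotation makes it zero;
  a further quarter turn exchanges the two vectors up to sign, which settles the order of the norms.
\<close>

lemma exists_orthogonal_rotation:
  fixes X Y :: "'a::real_inner"
  shows "\<exists>a b. a\<^sup>2 + b\<^sup>2 = 1 \<and> (a *\<^sub>R X + b *\<^sub>R Y) \<bullet> (- b *\<^sub>R X + a *\<^sub>R Y) = 0 \<and>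
    norm (a *\<^sub>R X + b *\<^sub>R Y) \<le> norm (- b *\<^sub>R X + a *\<^sub>R Y)"
proof -
  define g where "g t = (cos t *\<^sub>R X + sin t *\<^sub>R Y) \<bullet> (- sin t *\<^sub>R X + cos t *\<^sub>R Y)" for t
  have cont: "continuous_on {0..pi/2} g"
    unfolding g_def by (intro continuous_intros)
  have g0: "g 0 = X \<bullet> Y" and g1: "g (pi/2) = - (X \<bullet> Y)"
    by (simp_all add: g_def inner_commute)
  have "\<exists>t. g t = 0"
  proof (cases "X \<bullet> Y \<le> 0")
    case True
    then show ?thesis using IVT'[of g 0 0 "pi/2"] cont g0 g1 by auto
  next
    case False
    then show ?thesis using IVT2'[of g "pi/2" 0 0] cont g0 g1 by auto
  qed
  then obtain t where t: "g t = 0" ..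
  define a b where "a = cos t" and "b = sin t"
  have ab: "a\<^sup>2 + b\<^sup>2 = 1" by (simp add: a_def b_def)
  have orth: "(a *\<^sub>R X + b *\<^sub>R Y) \<bullet> (- b *\<^sub>R X + a *\<^sub>R Y) = 0"
    using t by (simp add: g_def a_def b_def)
  show ?thesis
  proof (cases "norm (a *\<^sub>R X + b *\<^sub>R Y) \<le> norm (- b *\<^sub>R X + a *\<^sub>R Y)")
    case True
    then show ?thesis using ab orth by blast
  next
    case False
    have 1: "- a *\<^sub>R X + - b *\<^sub>R Y = - (a *\<^sub>R X + b *\<^sub>R Y)" by simp
    show ?thesis
    proof (intro exI conjI)
      show "(- b)\<^sup>2 + a\<^sup>2 = 1" using ab by simp
      show "(- b *\<^sub>R X + a *\<^sub>R Y) \<bullet> (- a *\<^sub>R X + - b *\<^sub>R Y) = 0"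
        unfolding 1 using orth by (simp only: inner_minus_right inner_commute)
      show "norm (- b *\<^sub>R X + a *\<^sub>R Y) \<le> norm (- a *\<^sub>R X + - b *\<^sub>R Y)"
        unfolding 1 norm_minus_cancel using False by simp
    qed
  qed
qed

lemma gram_linear_combination:
  "gram (a *\<^sub>R X + b *\<^sub>R Y) (c *\<^sub>R X + e *\<^sub>R Y) = (a * e - b * c)\<^sup>2 * gram X Y"
proof -
  have s: "Y \<bullet> X = X \<bullet> Y" by (rule inner_commute)
  show ?thesis
    unfolding gram_def inner_simps s by algebra
qed

lemma gram_nonneg: "gram X Y \<ge> 0"
  using Cauchy_Schwarz_ineq[of X Y] by (simp add: gram_def)

lemma
  fixes A B C :: "real^'n^'n"
  shows matrix_mult_add_right: "A ** (B + C) = A ** B + A ** C"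
    and matrix_mult_add_left: "(B + C) ** A = B ** A + C ** A"
    and matrix_mult_scaleR_right: "A ** (t *\<^sub>R B) = t *\<^sub>R (A ** B)"
    and matrix_mult_scaleR_left: "(t *\<^sub>R A) ** B = t *\<^sub>R (A ** B)"
  by (simp_all add: matrix_matrix_mult_def vec_eq_iff sum_distrib_left algebra_simps flip: sum.distrib)

lemmas matrix_mult_linear = matrix_mult_add_right matrix_mult_add_left matrix_mult_scaleR_right
  matrix_mult_scaleR_left

lemma
  fixes A B :: "real^'n^'n"
  shows transpose_add: "transpose (A + B) = transpose A + transpose B"
    and transpose_scaleR: "transpose (t *\<^sub>R A) = t *\<^sub>R transpose A"
  by (simp_all add: transpose_def vec_eq_iff)

lemma linear_congr: "linear (congr M)"
  by (rule linearI) (simp_all add: congr_def matrix_mult_linear)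

lemma congr_add: "congr M (X + Y) = congr M X + congr M Y"
  and congr_scaleR: "congr M (c *\<^sub>R X) = c *\<^sub>R congr M X"
  using linear_add[OF linear_congr] linear_scale[OF linear_congr] by auto

lemma congr_congr: "congr M (congr N X) = congr (M ** N) X"
  by (simp add: congr_def matrix_mul_assoc matrix_transpose_mul)

lemma congr_mat_1: "congr (mat 1) X = X"
  by (simp add: congr_def transpose_mat)

lemma tendsto_congr: "(X \<longlongrightarrow> X') F \<Longrightarrow> ((\<lambda>k. congr M (X k)) \<longlongrightarrow> congr M X') F"
  by (rule bounded_linear.tendsto[OF linear_congr[unfolded linear_conv_bounded_linear]])

lemma degenerate_at_congr:
  assumes "det M = 1"
  shows "degenerate_at (congr M A) (congr M B) a b a' b' = degenerate_at A B a b a' b'"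
  using assms by (simp add: degenerate_at_def line_det_congr flip: congr_add congr_scaleR)

lemma line_det_0_0: "line_det 0 (0::real^'n^'n) = 0"
proof -
  have "row i (\<chi> i j. [:0 $ i $ j, 0 $ i $ j:] :: real poly^'n^'n) = 0" for i
    by (simp add: row_def vec_eq_iff)
  then show ?thesis unfolding line_det_def by (rule det_zero_row(1))
qed

text \<open>
  If the area spanned by \<open>M A M\<^sup>T\<close> and \<open>M B M\<^sup>T\<close> is small, then after a rotation these two matrices are
  orthogonal and the product of their norms is small. The torus makes both of them small. It does so
  by enlarging the shorter one, and hence it does not decrease the coefficients of index at most
  \<open>d / 2\<close>. Since congruence by \<open>M\<close> does not change the determinant form, these coefficients of the
  rotated original pencil are bounded by those of a pair of small matrices.
\<close>

lemma small_representative: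
  fixes A B :: "real^'n^'n"
  assumes small: "\<And>\<epsilon>. \<epsilon> > 0 \<Longrightarrow> \<exists>M. det M = 1 \<and> gram (congr M A) (congr M B) < \<epsilon>"
    and \<delta>: "\<delta> > 0"
  shows "\<exists>a b (U :: real^'n^'n) V. a\<^sup>2 + b\<^sup>2 = 1 \<and> norm U \<le> \<delta> \<and> norm V \<le> \<delta> \<and>
    (\<forall>j \<le> CARD('n) div 2.
       \<bar>coeff (line_det (a *\<^sub>R A + b *\<^sub>R B) (- b *\<^sub>R A + a *\<^sub>R B)) j\<bar> \<le> \<bar>coeff (line_det U V) j\<bar>)"
proof -
  obtain M where M: "det M = 1" and gM: "gram (congr M A) (congr M B) < \<delta> ^ 4"
    using small[of "\<delta> ^ 4"] \<delta> by auto
  obtain a b where ab: "a\<^sup>2 + b\<^sup>2 = 1"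
    and orth: "(a *\<^sub>R congr M A + b *\<^sub>R congr M B) \<bullet> (- b *\<^sub>R congr M A + a *\<^sub>R congr M B) = 0"
    and le: "norm (a *\<^sub>R congr M A + b *\<^sub>R congr M B) \<le> norm (- b *\<^sub>R congr M A + a *\<^sub>R congr M B)"
    using exists_orthogonal_rotation by blast
  define X where "X = a *\<^sub>R congr M A + b *\<^sub>R congr M B"
  define Y where "Y = - b *\<^sub>R congr M A + a *\<^sub>R congr M B"
  have X: "X = congr M (a *\<^sub>R A + b *\<^sub>R B)" and Y: "Y = congr M (- b *\<^sub>R A + a *\<^sub>R B)"
    by (simp_all only: X_def Y_def congr_add congr_scaleR)
  have "gram X Y = (a * a - b * - b)\<^sup>2 * gram (congr M A) (congr M B)"
    unfolding X_def Y_def by (rule gram_linear_combination)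
  also have "a * a - b * - b = 1" using ab by (simp add: power2_eq_square)
  finally have "gram X Y < \<delta> ^ 4" using gM by simp
  moreover have "gram X Y = (norm X * norm Y)\<^sup>2"
    using orth unfolding gram_def X_def[symmetric] Y_def[symmetric]
    by (simp add: power2_norm_eq_inner[symmetric] power_mult_distrib)
  ultimately have "(norm X * norm Y)\<^sup>2 < (\<delta>\<^sup>2)\<^sup>2" by simp
  then have XY: "norm X * norm Y < \<delta>\<^sup>2"
    by (rule power_less_imp_less_base) simp
  have le': "norm X \<le> norm Y" using le by (simp add: X_def Y_def)
  (* The smallest scaling by at least one that brings Y down to norm delta; X stays small
     because the product of the norms is at most delta^2. *)
  define l where "l = max 1 (norm Y / \<delta>)"
  have l: "l \<ge> 1" "norm Y / \<delta> \<le> l" by (auto simp: l_def)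
  have "(norm X)\<^sup>2 \<le> norm X * norm Y" using le' by (simp add: power2_eq_square mult_left_mono)
  then have "(norm X)\<^sup>2 \<le> \<delta>\<^sup>2" using XY by linarith
  then have "norm X \<le> \<delta>" by (rule power2_le_imp_le) (rule less_imp_le[OF \<delta>])
  moreover have "norm Y / \<delta> * norm X \<le> \<delta>"
  proof -
    have "norm Y / \<delta> * norm X = norm X * norm Y / \<delta>" by simp
    also have "\<dots> \<le> \<delta>\<^sup>2 / \<delta>" using XY \<delta> by (intro divide_right_mono) auto
    finally show ?thesis using \<delta> by (simp add: power2_eq_square)
  qed
  ultimately have U: "norm (l *\<^sub>R X) \<le> \<delta>"
    by (auto simp: l_def max_def)
  have V: "norm (inverse l *\<^sub>R Y) \<le> \<delta>"
  proof -
    have "norm Y \<le> l * \<delta>" using l(2) \<delta> by (simp add: pos_divide_le_eq)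
    then show ?thesis using l(1) by (simp add: divide_inverse_commute[symmetric] pos_divide_le_eq mult.commute)
  qed
  have "\<bar>coeff (line_det (a *\<^sub>R A + b *\<^sub>R B) (- b *\<^sub>R A + a *\<^sub>R B)) j\<bar>
      \<le> \<bar>coeff (line_det (l *\<^sub>R X) (inverse l *\<^sub>R Y)) j\<bar>" if j: "j \<le> CARD('n) div 2" for j
  proof -
    have "l ^ CARD('n) * (inverse l ^ 2) ^ j = l ^ (CARD('n) - 2 * j)"
      using l(1) j by (simp add: power_diff power_inverse flip: power_mult divide_inverse)
    moreover have "l ^ (CARD('n) - 2 * j) \<ge> 1" using l(1) by (simp add: one_le_power)
    moreover have "coeff (line_det X Y) j = coeff (line_det (a *\<^sub>R A + b *\<^sub>R B) (- b *\<^sub>R A + a *\<^sub>R B)) j"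
      unfolding X Y line_det_congr M by simp
    ultimately show ?thesis
      using l(1) mult_right_mono[of 1 "l ^ (CARD('n) - 2 * j)" "\<bar>coeff (line_det X Y) j\<bar>"]
      by (subst line_det_scale) (simp_all add: abs_mult)
  qed
  note coeff_le = this
  show ?thesis
  proof (intro exI conjI allI impI)
    show "a\<^sup>2 + b\<^sup>2 = 1" by (rule ab)
    show "norm (l *\<^sub>R X) \<le> \<delta>" by (rule U)
    show "norm (inverse l *\<^sub>R Y) \<le> \<delta>" by (rule V)
  qed (rule coeff_le)
qed

text \<open>
  The rotations are taken from the compact circle, so a subsequence converges, and in the limit the
  coefficients of index at most \<open>d / 2\<close> vanish.
\<close>

lemma small_gram_imp_degenerate:
  fixes A B :: "real^'n^'n"
  assumes small: "\<And>\<epsilon>. \<epsilon> > 0 \<Longrightarrow> \<exists>M. det M = 1 \<and> gram (congr M A) (congr M B) < \<epsilon>"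
  shows "\<exists>a b. a\<^sup>2 + b\<^sup>2 = 1 \<and> degenerate_at A B a b (- b) a"
proof -
  let ?D = "\<lambda>a b. line_det (a *\<^sub>R A + b *\<^sub>R B) (- b *\<^sub>R A + a *\<^sub>R B)"
  have "\<forall>n. \<exists>a b (U :: real^'n^'n) V. a\<^sup>2 + b\<^sup>2 = 1 \<and> norm U \<le> inverse (real (Suc n)) \<and> norm V \<le> inverse (real (Suc n)) \<and>
    (\<forall>j \<le> CARD('n) div 2. \<bar>coeff (?D a b) j\<bar> \<le> \<bar>coeff (line_det U V) j\<bar>)"
    by (intro allI small_representative small) auto
  then obtain a b and U V :: "nat \<Rightarrow> real^'n^'n" where ab: "\<And>n. (a n)\<^sup>2 + (b n)\<^sup>2 = 1"
    and UV: "\<And>n. norm (U n) \<le> inverse (real (Suc n))" "\<And>n. norm (V n) \<le> inverse (real (Suc n))"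
    and le: "\<And>n j. j \<le> CARD('n) div 2 \<Longrightarrow> \<bar>coeff (?D (a n) (b n)) j\<bar> \<le> \<bar>coeff (line_det (U n) (V n)) j\<bar>"
    by metis
  have U: "U \<longlonglongrightarrow> 0" and V: "V \<longlonglongrightarrow> 0"
    using UV by (auto intro!: Lim_null_comparison[OF _ LIMSEQ_inverse_real_of_nat] always_eventually)
  have "norm (a n, b n) \<le> 1" for n
    using ab[of n] by (simp add: norm_prod_def)
  then have "bounded (range (\<lambda>n. (a n, b n)))"
    by (auto simp: bounded_iff)
  then obtain ab' r where r: "strict_mono (r :: nat \<Rightarrow> nat)" and lim: "((\<lambda>n. (a n, b n)) \<circ> r) \<longlonglongrightarrow> ab'"
    using bounded_imp_convergent_subsequence by blast
  define a' b' where "a' = fst ab'" and "b' = snd ab'"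
  have a': "(\<lambda>n. a (r n)) \<longlonglongrightarrow> a'" and b': "(\<lambda>n. b (r n)) \<longlonglongrightarrow> b'"
    using tendsto_fst[OF lim] tendsto_snd[OF lim] by (simp_all add: o_def a'_def b'_def)
  have "(\<lambda>n. (a (r n))\<^sup>2 + (b (r n))\<^sup>2) \<longlonglongrightarrow> a'\<^sup>2 + b'\<^sup>2"
    by (intro tendsto_intros a' b')
  then have "a'\<^sup>2 + b'\<^sup>2 = 1" by (simp add: ab LIMSEQ_const_iff)
  moreover have "coeff (?D a' b') j = 0" if j: "j \<le> CARD('n) div 2" for j
  proof -
    have "(\<lambda>n. coeff (?D (a (r n)) (b (r n))) j) \<longlonglongrightarrow> coeff (?D a' b') j"
      by (intro coeff_line_det_tendsto tendsto_intros a' b')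
    moreover have "(\<lambda>n. coeff (line_det (U n) (V n)) j) \<longlonglongrightarrow> 0"
      using coeff_line_det_tendsto[OF U V, of j] by (simp add: line_det_0_0)
    then have "(\<lambda>n. coeff (?D (a n) (b n)) j) \<longlonglongrightarrow> 0"
      by (rule Lim_transform_bound[rotated]) (use le[OF j] in auto)
    then have "(\<lambda>n. coeff (?D (a (r n)) (b (r n))) j) \<longlonglongrightarrow> 0"
      using LIMSEQ_subseq_LIMSEQ[OF _ r] by (fastforce simp: o_def)
    ultimately show ?thesis by (rule LIMSEQ_unique)
  qed
  ultimately show ?thesis unfolding degenerate_at_def by blast
qed

section \<open>Minimal pairs in the orbit\<close>

lemma inner_matrix_eq_trace: "X \<bullet> Y = trace (X ** transpose Y)" for X Y :: "real^'n^'n"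
  by (simp add: inner_vec_def trace_def matrix_matrix_mult_def transpose_def)

lemma inner_transpose: "transpose X \<bullet> transpose Y = X \<bullet> Y" for X Y :: "real^'n^'n"
  unfolding inner_vec_def by (simp add: transpose_def, rule sum.swap)

definition matrix_unit :: "'n \<Rightarrow> 'n \<Rightarrow> real^'n^'n" where
  "matrix_unit p q = (\<chi> a b. if a = p \<and> b = q then 1 else 0)"

lemma matrix_unit_mult: "matrix_unit p q ** matrix_unit r s = (if q = r then matrix_unit p s else 0)"
proof -
  have "(\<Sum>k\<in>UNIV. (if a = p \<and> k = q then 1 else 0) * (if k = r \<and> b = s then 1 else 0 :: real)) =
      (if q = r \<and> a = p \<and> b = s then 1 else 0)" for a b
  proof -
    have "(\<Sum>k\<in>UNIV. (if a = p \<and> k = q then 1 else 0) * (if k = r \<and> b = s then 1 else 0 :: real)) =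
       (\<Sum>k\<in>UNIV. if k = q then if q = r \<and> a = p \<and> b = s then 1 else 0 else 0)"
      by (rule sum.cong) auto
    then show ?thesis by simp
  qed
  then show ?thesis by (simp add: matrix_unit_def matrix_matrix_mult_def vec_eq_iff)
qed

lemma inner_matrix_unit: "matrix_unit p q \<bullet> G = G $ p $ q"
proof -
  have "(\<Sum>b\<in>UNIV. (if a = p \<and> b = q then 1 else 0) * G $ a $ b) = (if a = p then G $ p $ q else 0)" for a
  proof -
    have "(\<Sum>b\<in>UNIV. (if a = p \<and> b = q then 1 else 0) * G $ a $ b) =
       (\<Sum>b\<in>UNIV. if b = q then if a = p then G $ p $ q else 0 else 0)"
      by (rule sum.cong) auto
    then show ?thesis by simp
  qed
  then show ?thesis by (simp add: matrix_unit_def inner_vec_def)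
qed

lemma det_transvection:
  assumes "p \<noteq> q"
  shows "det (mat 1 + t *\<^sub>R matrix_unit p q) = 1"
proof -
  have "mat 1 + t *\<^sub>R matrix_unit p q =
      (\<chi> k. if k = p then row p (mat 1) + t *s row q (mat 1) else row k (mat 1))"
    by (auto simp: vec_eq_iff matrix_unit_def row_def mat_def)
  then show ?thesis using det_row_operation[OF assms, of "mat 1" t] by simp
qed

text \<open>
  The first variation of the area along the curve \<open>1 + t S\<close> of matrices of determinant one. For
  orthogonal \<open>A\<close> and \<open>B\<close> of equal norm it is a multiple of the trace of \<open>S (A\<^sup>2 + B\<^sup>2)\<close>.
\<close>

lemma gram_critical:
  fixes A B S :: "real^'n^'n"
  assumes sym: "transpose A = A" "transpose B = B"
    and orth: "A \<bullet> B = 0" and eq: "A \<bullet> A = B \<bullet> B" and pos: "A \<bullet> A > 0"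
    and min: "\<And>M. det M = 1 \<Longrightarrow> gram A B \<le> gram (congr M A) (congr M B)"
    and S: "\<And>t. det (mat 1 + t *\<^sub>R S) = 1"
  shows "S \<bullet> (A ** A + B ** B) = 0"
proof -
  define X1 where "X1 X = S ** X + X ** transpose S" for X
  define X2 where "X2 X = S ** X ** transpose S" for X
  have congr: "congr (mat 1 + t *\<^sub>R S) X = X + t *\<^sub>R X1 X + t\<^sup>2 *\<^sub>R X2 X" for t X
    by (simp add: congr_def X1_def X2_def matrix_mult_linear transpose_add transpose_scaleR
        power2_eq_square algebra_simps)
  have inner: "X \<bullet> X1 X = 2 * (S \<bullet> (X ** X))" if X: "transpose X = X" for X
  proof -
    have 1: "X \<bullet> (X ** transpose S) = X \<bullet> (S ** X)"
      using inner_transpose[of X "X ** transpose S"] X by (simp add: matrix_transpose_mul)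
    have "X \<bullet> (X ** transpose S) = trace (X ** (S ** X))"
      using X by (simp add: inner_matrix_eq_trace matrix_transpose_mul)
    also have "\<dots> = trace ((S ** X) ** X)" by (rule trace_mul_sym)
    also have "\<dots> = S \<bullet> (X ** X)"
      using X by (simp add: inner_matrix_eq_trace matrix_transpose_mul matrix_mul_assoc)
    finally show ?thesis using 1 by (simp add: X1_def inner_add_right)
  qed
  define f where "f t = gram (congr (mat 1 + t *\<^sub>R S) A) (congr (mat 1 + t *\<^sub>R S) B)" for t
  (* f is a polynomial in t whose linear coefficient is its derivative at 0; as A and B are
     orthogonal, the square of their inner product contributes only from order t^2 on. *)
  have f: "f t = (A \<bullet> A + 2 * t * (A \<bullet> X1 A) + t\<^sup>2 * (X1 A \<bullet> X1 A + 2 * (A \<bullet> X2 A)) + 2 * t ^ 3 * (X1 A \<bullet> X2 A) + t ^ 4 * (X2 A \<bullet> X2 A)) *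
     (B \<bullet> B + 2 * t * (B \<bullet> X1 B) + t\<^sup>2 * (X1 B \<bullet> X1 B + 2 * (B \<bullet> X2 B)) + 2 * t ^ 3 * (X1 B \<bullet> X2 B) + t ^ 4 * (X2 B \<bullet> X2 B)) -
     (t * ((A \<bullet> X1 B) + (X1 A \<bullet> B) + t * (A \<bullet> X2 B + X1 A \<bullet> X1 B + X2 A \<bullet> B) + t\<^sup>2 * (X1 A \<bullet> X2 B + X2 A \<bullet> X1 B) + t ^ 3 * (X2 A \<bullet> X2 B)))\<^sup>2" for t
  proof -
    have "X1 A \<bullet> A = A \<bullet> X1 A" "X2 A \<bullet> A = A \<bullet> X2 A" "X2 A \<bullet> X1 A = X1 A \<bullet> X2 A"
      "X1 B \<bullet> B = B \<bullet> X1 B" "X2 B \<bullet> B = B \<bullet> X2 B" "X2 B \<bullet> X1 B = X1 B \<bullet> X2 B"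
      by (simp_all add: inner_commute)
    note c = this
    show ?thesis
      unfolding f_def congr gram_def inner_simps c orth by algebra
  qed
  have "(f has_real_derivative (2 * (A \<bullet> X1 A) * (B \<bullet> B) + (A \<bullet> A) * (2 * (B \<bullet> X1 B)))) (at 0)"
    unfolding f by (auto intro!: derivative_eq_intros)
  moreover have "f 0 \<le> f t" for t
    using min[OF S[of t]] by (simp add: f_def congr congr_mat_1)
  ultimately have "2 * (A \<bullet> X1 A) * (B \<bullet> B) + (A \<bullet> A) * (2 * (B \<bullet> X1 B)) = 0"
    by (intro DERIV_local_min[where d = 1]) auto
  then have "2 * (A \<bullet> A) * ((A \<bullet> X1 A) + (B \<bullet> X1 B)) = 0"
    by (simp add: eq algebra_simps)
  then show ?thesis
    using pos by (simp add: inner sym inner_add_right)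
qed

text \<open>
  The moment map equation: at a minimum of the area in its orbit the symmetric matrix \<open>A\<^sup>2 + B\<^sup>2\<close> is
  orthogonal to all nilpotent \<open>S\<close> of square zero and rank one, and these span the matrices of trace
  zero.
\<close>

lemma gram_minimum_scalar:
  fixes A B :: "real^'n^'n"
  assumes sym: "transpose A = A" "transpose B = B"
    and orth: "A \<bullet> B = 0" and eq: "A \<bullet> A = B \<bullet> B" and pos: "A \<bullet> A > 0"
    and min: "\<And>M. det M = 1 \<Longrightarrow> gram A B \<le> gram (congr M A) (congr M B)"
  shows "\<exists>c > 0. A ** A + B ** B = c *\<^sub>R mat 1"
proof -
  define G where "G = A ** A + B ** B"
  have crit: "S \<bullet> G = 0" if "\<And>t. det (mat 1 + t *\<^sub>R S) = 1" for S
    unfolding G_def using gram_critical[OF sym orth eq pos min that] by blast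
  have off: "G $ p $ q = 0" if "p \<noteq> q" for p q
    using crit[OF det_transvection[OF that]] by (simp add: inner_matrix_unit)
  have diag: "G $ p $ p = G $ q $ q" for p q
  proof (cases "p = q")
    case False
    (* The transvection (e_p + e_q)(e_p - e_q)^T, a conjugate of the elementary one; pairing it
       with G compares two diagonal entries. *)
    define S where "S = matrix_unit p p - matrix_unit p q + matrix_unit q p - matrix_unit q q"
    have "mat 1 + t *\<^sub>R S = (mat 1 + 1 *\<^sub>R matrix_unit p q) ** (mat 1 + t *\<^sub>R matrix_unit q p) ** (mat 1 + (- 1) *\<^sub>R matrix_unit p q)" for t
    proof -
      have diff: "X ** (mat 1 - matrix_unit p q) = X - X ** matrix_unit p q" for X :: "real^'n^'n"
        using matrix_mult_add_right[of X "mat 1" "- 1 *\<^sub>R matrix_unit p q"]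
        unfolding matrix_mult_scaleR_right by simp
      show ?thesis
        using False by (simp add: S_def matrix_mult_linear matrix_unit_mult diff) (simp add: algebra_simps)
    qed
    then have "det (mat 1 + t *\<^sub>R S) = 1" for t
      by (simp only: det_mul det_transvection[OF False] det_transvection[OF False[symmetric]] mult_1)
    then have "S \<bullet> G = 0" by (rule crit)
    then show ?thesis
      using False by (simp add: S_def inner_diff_left inner_add_left inner_matrix_unit off)
  qed simp
  define c where "c = G $ undefined $ undefined"
  have G: "G = c *\<^sub>R mat 1"
    using off diag[of _ undefined] by (auto simp: vec_eq_iff mat_def c_def)
  have "c * CARD('n) = trace G"
    by (simp add: G trace_def mat_def)
  also have "\<dots> = A \<bullet> A + B \<bullet> B"
    by (simp add: G_def trace_add inner_matrix_eq_trace sym)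
  finally have "c * CARD('n) > 0" using eq pos by simp
  then have "c > 0" by (simp add: zero_less_mult_iff)
  then show ?thesis using G unfolding G_def by blast
qed

text \<open>
  The order of vanishing at \<open>0\<close> of \<open>det (B + x A)\<close> is the dimension of the kernel of \<open>B\<close>: a basis of
  the kernel contributes one factor \<open>x\<close> for each of its vectors, and the remaining determinant is
  invertible because \<open>A\<^sup>2\<close> acts as the scalar \<open>c\<close> on the kernel, which \<open>A\<close> preserves. This dimension
  is at most \<open>d / 2\<close>, since \<open>A\<close> and \<open>B\<close> have the same norm: \<open>c\<close> times the dimension is a part of the
  trace of \<open>A\<^sup>2\<close>, which is half of \<open>c d\<close>. Here the coordinates are assumed to be adapted to the kernel.
\<close>

lemma adapted_coefficient:
  fixes A B :: "real^'n^'n"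
  assumes sym: "transpose A = A" "transpose B = B" and eq: "A \<bullet> A = B \<bullet> B"
    and c: "c > 0" "A ** A + B ** B = c *\<^sub>R mat 1"
    and J0: "\<And>i. i \<in> J \<Longrightarrow> B $ i = 0"
    and J1: "\<And>x j. B *v x = 0 \<Longrightarrow> j \<notin> J \<Longrightarrow> x $ j = 0"
  shows "card J \<le> CARD('n) div 2 \<and> coeff (line_det B A) (card J) \<noteq> 0"
proof
  have rows: "(X ** X) $ i $ i = X $ i \<bullet> X $ i" if "transpose X = X" for X :: "real^'n^'n" and i
  proof -
    have "X $ k $ i = X $ i $ k" for k using that by (metis transpose_def vec_lambda_beta)
    then show ?thesis by (simp add: matrix_matrix_mult_def inner_vec_def)
  qed
  have "A $ i \<bullet> A $ i = c" if "i \<in> J" for i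
  proof -
    have "(A ** A) $ i $ i + (B ** B) $ i $ i = c"
      using c(2) by (simp add: vec_eq_iff mat_def)
    then show ?thesis using J0[OF that] by (simp add: rows sym)
  qed
  then have "c * card J = (\<Sum>i\<in>J. A $ i \<bullet> A $ i)" by simp
  also have "\<dots> \<le> (\<Sum>i\<in>UNIV. A $ i \<bullet> A $ i)" by (rule sum_mono2) auto
  also have "\<dots> = A \<bullet> A" by (simp add: inner_vec_def)
  finally have "2 * (c * card J) \<le> A \<bullet> A + B \<bullet> B" using eq by simp
  also have "\<dots> = trace (A ** A + B ** B)"
    by (simp add: trace_add inner_matrix_eq_trace sym)
  also have "\<dots> = c * CARD('n)" by (simp add: c(2) trace_def mat_def)
  finally have "c * (2 * card J) \<le> c * CARD('n)" by simp
  then show "card J \<le> CARD('n) div 2" using c(1) by simp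

  (* The rows in J of B + x A are divisible by x. P is what remains of the polynomial matrix,
     and G is its value at x = 0. *)
  define G where "G = (\<chi> i. if i \<in> J then A $ i else B $ i)"
  define P where "P = (\<chi> i j. if i \<in> J then [:A $ i $ j:] else [:B $ i $ j, A $ i $ j:])"
  have "line_det B A = det (\<chi> i. (if i \<in> J then [:0, 1:] else 1) *s P $ i)"
    unfolding line_det_def P_def by (intro arg_cong[where f = det]) (auto simp: vec_eq_iff J0)
  also have "\<dots> = (\<Prod>i\<in>UNIV. if i \<in> J then [:0, 1:] else 1) * det P"
    by (subst det_rows_mul) simp
  also have "(\<Prod>i\<in>UNIV. if i \<in> J then [:0, 1:] else 1) = (monom 1 1 :: real poly) ^ card J"
    by (simp add: prod.If_cases monom_altdef)
  finally have "coeff (line_det B A) (card J) = coeff (det P) 0"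
    by (simp add: monom_power coeff_monom_mult)
  also have "\<dots> = det G"
    unfolding poly_0_coeff_0[symmetric]
    by (subst comm_ring_map.det[OF comm_ring_map_poly], rule arg_cong[where f = det])
       (auto simp: vec_eq_iff P_def G_def)
  also have "\<dots> \<noteq> 0"
  proof -
    have "x = 0" if x: "G *v x = 0" for x
    proof -
      have row: "(X *v x) $ i = X $ i \<bullet> x" for X i by (simp add: matrix_vector_mult_def inner_vec_def)
      have Gi: "G $ i \<bullet> x = 0" for i using x row[of G i] by simp
      have "B $ i \<bullet> x = 0" for i using Gi[of i] J0[of i] by (auto simp: G_def split: if_splits)
      then have Bx: "B *v x = 0" by (simp add: vec_eq_iff row)
      have AA: "A *v (A *v y) + B *v (B *v y) = c *\<^sub>R y" for y
      proof -
        have "A *v (A *v y) + B *v (B *v y) = (A ** A + B ** B) *v y"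
          by (simp only: matrix_vector_mult_add_rdistrib matrix_vector_mul_assoc)
        also have "\<dots> = c *\<^sub>R (mat 1 *v y)"
          by (simp only: c(2) scaleR_matrix_vector_assoc)
        finally show ?thesis by simp
      qed
      (* B x = 0. As B^2 = c - A^2 commutes with A, also B (A x) = 0, so A x lies in the kernel
         of B and has no coordinates outside J; those in J vanish because G x = 0. *)
      have AAx: "A *v (A *v x) = c *\<^sub>R x" using AA[of x] Bx by simp
      have "A *v (A *v (A *v x)) + B *v (B *v (A *v x)) = c *\<^sub>R (A *v x)" by (rule AA)
      then have "B *v (B *v (A *v x)) = 0"
        unfolding AAx by (simp add: matrix_vector_mult_scaleR)
      then have "(B *v (A *v x)) \<bullet> (B *v (A *v x)) = 0"
        by (metis dot_lmul_matrix inner_zero_right sym(2) transpose_matrix_vector)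
      then have BAx: "B *v (A *v x) = 0" by simp
      have "(A *v x) $ i = 0" for i
        using J1[OF BAx, of i] Gi[of i] by (cases "i \<in> J") (simp_all add: G_def row)
      then have "A *v x = 0" by (simp add: vec_eq_iff)
      then show "x = 0" using AAx c(1) by simp
    qed
    then have "\<exists>H. H ** G = mat 1" by (simp add: matrix_left_invertible_ker)
    then show ?thesis by (metis det_I det_mul mult_zero_right zero_neq_one)
  qed
  finally show "coeff (line_det B A) (card J) \<noteq> 0" .
qed

lemma exists_adapted_orthonormal_basis:
  fixes K :: "(real^'n) set"
  assumes "subspace K"
  shows "\<exists>(f :: 'n \<Rightarrow> real^'n) J. (\<forall>i j. f i \<bullet> f j = (if i = j then 1 else 0)) \<and> (\<forall>i\<in>J. f i \<in> K) \<and>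
    (\<forall>i. i \<notin> J \<longrightarrow> (\<forall>x\<in>K. f i \<bullet> x = 0))" (is "\<exists>f J. ?P f J")
proof -
  define K' where "K' = {y. \<forall>x\<in>K. orthogonal x y}"
  have "subspace K'" unfolding K'_def by (rule subspace_orthogonal_to_vectors)
  obtain S1 where S1: "S1 \<subseteq> K" "pairwise orthogonal S1" "\<And>x. x \<in> S1 \<Longrightarrow> norm x = 1"
      "independent S1" "card S1 = dim K"
    using orthonormal_basis_subspace[OF assms] by metis
  obtain S2 where S2: "S2 \<subseteq> K'" "pairwise orthogonal S2" "\<And>x. x \<in> S2 \<Longrightarrow> norm x = 1"
      "independent S2" "card S2 = dim K'"
    using orthonormal_basis_subspace[OF \<open>subspace K'\<close>] by metis
  have fin: "finite S1" "finite S2" using S1(4) S2(4) by (auto intro: independent_imp_finite)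
  have perp: "x \<bullet> y = 0" if "x \<in> S1" "y \<in> S2" for x y
    using that S1(1) S2(1) by (auto simp: K'_def orthogonal_def)
  have disj: "S1 \<inter> S2 = {}"
    using perp S1(3) by (auto simp: disjoint_iff norm_eq_1) (metis zero_neq_one)
  have "dim K' + dim K = DIM(real^'n)"
    using dim_subspace_orthogonal_to_vectors[OF assms subspace_UNIV] by (simp add: K'_def)
  then have "card (S1 \<union> S2) = CARD('n)"
    using fin disj S1(5) S2(5) by (simp add: card_Un_disjoint)
  then obtain f :: "'n \<Rightarrow> real^'n" where f: "bij_betw f UNIV (S1 \<union> S2)"
    using finite_same_card_bij[of "UNIV :: 'n set" "S1 \<union> S2"] fin by auto
  have mem: "f i \<in> S1 \<union> S2" for i using f by (auto simp: bij_betw_def)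
  have inj: "f i = f j \<longleftrightarrow> i = j" for i j using f by (auto simp: bij_betw_def inj_def)
  have "f i \<bullet> f j = (if i = j then 1 else 0)" for i j
  proof (cases "i = j")
    case True
    then show ?thesis using mem[of j] S1(3) S2(3) by (auto simp: norm_eq_1)
  next
    case False
    then have "f i \<noteq> f j" by (simp add: inj)
    then show ?thesis
      using False mem[of i] mem[of j] S1(2) S2(2) perp[of "f i" "f j"] perp[of "f j" "f i"]
      by (auto simp: pairwise_def orthogonal_def inner_commute)
  qed
  moreover have "f i \<in> K" if "f i \<in> S1" for i using that S1(1) by auto
  moreover have "f i \<bullet> x = 0" if "f i \<notin> S1" "x \<in> K" for i x
    using that mem[of i] S2(1) by (auto simp: K'_def orthogonal_def inner_commute)
  ultimately have "?P f {i. f i \<in> S1}" by simp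
  then show ?thesis by blast
qed

text \<open>
  All hypotheses are invariant under orthogonal changes of basis, so the coordinates may be adapted to
  the kernel of \<open>B\<close>.
\<close>

lemma scalar_imp_nonzero_coefficient:
  fixes A B :: "real^'n^'n"
  assumes sym: "transpose A = A" "transpose B = B" and eq: "A \<bullet> A = B \<bullet> B"
    and c: "c > 0" "A ** A + B ** B = c *\<^sub>R mat 1"
  shows "\<exists>k \<le> CARD('n) div 2. coeff (line_det B A) k \<noteq> 0"
proof -
  define K where "K = {x. B *v x = 0}"
  have "subspace K"
    unfolding K_def by (rule linear_subspace_kernel) simp
  then obtain f :: "'n \<Rightarrow> real^'n" and J where f: "\<And>i j. f i \<bullet> f j = (if i = j then 1 else 0)"
    and J: "\<And>i. i \<in> J \<Longrightarrow> f i \<in> K" and J': "\<And>i x. i \<notin> J \<Longrightarrow> x \<in> K \<Longrightarrow> f i \<bullet> x = 0"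
    using exists_adapted_orthonormal_basis[of K] by metis
  define R :: "real^'n^'n" where "R = (\<chi> i. f i)"
  have RRt: "R ** transpose R = mat 1"
    using f by (simp add: vec_eq_iff R_def matrix_matrix_mult_def transpose_def mat_def inner_vec_def)
  then have RtR: "transpose R ** R = mat 1" by (simp add: matrix_left_right_inverse)
  have detR: "(det R)\<^sup>2 = 1"
    using arg_cong[OF RRt, of det] by (simp add: det_mul power2_eq_square)
  have prod: "congr R X ** congr R Y = congr R (X ** Y)" for X Y
  proof -
    have "congr R X ** congr R Y = R ** X ** (transpose R ** R) ** Y ** transpose R"
      by (simp only: congr_def matrix_mul_assoc)
    then show ?thesis by (simp add: RtR congr_def matrix_mul_assoc)
  qed
  have symR: "transpose (congr R X) = congr R X" if "transpose X = X" for X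
    using that by (simp add: congr_def matrix_transpose_mul matrix_mul_assoc)
  have innerR: "congr R X \<bullet> congr R X = X \<bullet> X" if "transpose X = X" for X
  proof -
    have "congr R X \<bullet> congr R X = trace (R ** (X ** X ** transpose R))"
      using that by (simp add: inner_matrix_eq_trace symR prod) (simp add: congr_def matrix_mul_assoc)
    also have "\<dots> = trace (X ** X ** (transpose R ** R))"
      by (subst trace_mul_sym) (simp only: matrix_mul_assoc)
    finally show ?thesis using that by (simp add: RtR inner_matrix_eq_trace)
  qed
  have "card J \<le> CARD('n) div 2 \<and> coeff (line_det (congr R B) (congr R A)) (card J) \<noteq> 0"
  proof (rule adapted_coefficient)
    show "transpose (congr R A) = congr R A" "transpose (congr R B) = congr R B"
      by (simp_all add: symR sym)
    show "congr R A \<bullet> congr R A = congr R B \<bullet> congr R B"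
      by (simp add: innerR sym eq)
    show "congr R A ** congr R A + congr R B ** congr R B = c *\<^sub>R mat 1"
      by (simp add: prod c(2) congr_scaleR flip: congr_add) (simp add: congr_def RRt)
    show "congr R B $ i = 0" if "i \<in> J" for i
    proof -
      have "(R ** B) $ i $ j = (B *v f i) $ j" for j
      proof -
        have "B $ k $ j = B $ j $ k" for k
          using sym(2) by (metis transpose_def vec_lambda_beta)
        then have "f i $ k * B $ k $ j = B $ j $ k * f i $ k" for k by simp
        then show ?thesis
          unfolding matrix_matrix_mult_def matrix_vector_mult_def R_def vec_lambda_beta by (rule sum.cong[OF refl])
      qed
      then have "(R ** B) $ i = 0" using J[OF that] by (simp add: K_def vec_eq_iff)
      then show ?thesis
        by (simp add: congr_def vec_eq_iff) (simp add: matrix_matrix_mult_def[of "R ** B"])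
    qed
    show "x $ j = 0" if x: "congr R B *v x = 0" and j: "j \<notin> J" for x j
    proof -
      define y where "y = transpose R *v x"
      have Ry: "R *v y = x"
        unfolding y_def matrix_vector_mul_assoc RRt by simp
      have "transpose R *v (congr R B *v x) = B *v y"
        unfolding y_def congr_def matrix_vector_mul_assoc matrix_mul_assoc RtR by simp
      then have "y \<in> K" using x by (simp add: K_def)
      then have "f j \<bullet> y = 0" using J' j by blast
      moreover have "(R *v y) $ j = f j \<bullet> y"
        by (simp add: R_def matrix_vector_mult_def inner_vec_def)
      ultimately show ?thesis by (simp add: Ry)
    qed
  qed (rule c)
  then show ?thesis using detR by (auto simp: line_det_congr)
qed

section \<open>A root of high multiplicity forces small areas\<close>

text \<open>
  A linear change of the basis of the pencil only moves the point \<open>(a, b)\<close>, and normalizing it again to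
  the unit circle rescales the coefficients. All directions \<open>(a', b')\<close> are admitted here because the
  change of basis does not preserve orthogonality.
\<close>

lemma degenerate_at_basis_change:
  fixes A B :: "real^'n^'n"
  assumes deg: "\<And>a' b'. degenerate_at A B a b a' b'" and ab: "a\<^sup>2 + b\<^sup>2 = 1"
    and det: "p * s - q * r = 1"
    and X: "X = p *\<^sub>R A + q *\<^sub>R B" and Y: "Y = r *\<^sub>R A + s *\<^sub>R B"
  shows "\<exists>a b. a\<^sup>2 + b\<^sup>2 = 1 \<and> (\<forall>a' b'. degenerate_at X Y a b a' b')"
proof -
  (* The coordinates of the degenerate point with respect to X and Y. *)
  define a1 b1 where "a1 = a * s - b * r" and "b1 = b * p - a * q"
  have lin: "x *\<^sub>R X + y *\<^sub>R Y = (x * p + y * r) *\<^sub>R A + (x * q + y * s) *\<^sub>R B" for x y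
    by (simp add: X Y algebra_simps)
  have new_point: "a1 * p + b1 * r = a" "a1 * q + b1 * s = b"
    unfolding a1_def b1_def using det by algebra+
  define n where "n = sqrt (a1\<^sup>2 + b1\<^sup>2)"
  have "a1 \<noteq> 0 \<or> b1 \<noteq> 0" using new_point ab by auto
  then have pos: "a1\<^sup>2 + b1\<^sup>2 > 0" by (simp add: sum_power2_gt_zero_iff)
  then have n: "n > 0" "n\<^sup>2 = a1\<^sup>2 + b1\<^sup>2" by (simp_all add: n_def)
  have n0: "n \<noteq> 0" using n(1) by simp
  have "degenerate_at X Y (a1 / n) (b1 / n) a' b'" for a' b'
  proof -
    define u where "u = a' * p + b' * r"
    define v where "v = a' * q + b' * s"
    have "a1 / n * p + b1 / n * r = (a1 * p + b1 * r) / n" "a1 / n * q + b1 / n * s = (a1 * q + b1 * s) / n"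
      by (simp_all add: add_divide_distrib)
    then have 1: "(a1 / n) *\<^sub>R X + (b1 / n) *\<^sub>R Y = inverse n *\<^sub>R (a *\<^sub>R A + b *\<^sub>R B)"
      unfolding lin new_point by (simp add: divide_inverse scaleR_add_right mult.commute)
    have 2: "a' *\<^sub>R X + b' *\<^sub>R Y = inverse (inverse n) *\<^sub>R ((inverse n * u) *\<^sub>R A + (inverse n * v) *\<^sub>R B)"
    proof -
      have "inverse (inverse n) * (inverse n * z) = z" for z
        unfolding inverse_inverse_eq mult.assoc[symmetric] right_inverse[OF n0] mult_1 ..
      then show ?thesis unfolding lin scaleR_add_right scaleR_scaleR u_def v_def by (simp only:)
    qed
    show ?thesis
      unfolding degenerate_at_def 1 2
    proof (intro allI impI)
      fix j assume "j \<le> CARD('n) div 2"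
      then have "coeff (line_det (a *\<^sub>R A + b *\<^sub>R B) ((inverse n * u) *\<^sub>R A + (inverse n * v) *\<^sub>R B)) j = 0"
        using deg unfolding degenerate_at_def by blast
      then show "coeff (line_det (inverse n *\<^sub>R (a *\<^sub>R A + b *\<^sub>R B))
        (inverse (inverse n) *\<^sub>R ((inverse n * u) *\<^sub>R A + (inverse n * v) *\<^sub>R B))) j = 0"
        by (simp only: line_det_scale[OF nonzero_imp_inverse_nonzero[OF n0]] mult_zero_right)
    qed
  qed
  moreover have "(a1 / n)\<^sup>2 + (b1 / n)\<^sup>2 = 1"
  proof -
    have "(a1 / n)\<^sup>2 + (b1 / n)\<^sup>2 = (a1\<^sup>2 + b1\<^sup>2) / n\<^sup>2"
      by (simp only: power_divide add_divide_distrib)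
    also have "\<dots> = 1" unfolding n(2) by (rule divide_self) (rule less_imp_neq[OF pos, symmetric])
    finally show ?thesis .
  qed
  ultimately show ?thesis by blast
qed

text \<open>
  Conformal means orthogonal and of equal norms: a rotation makes the two vectors orthogonal, and the
  torus then makes their norms equal.
\<close>

lemma exists_conformal_basis:
  fixes A B :: "'a::real_inner"
  assumes "gram A B > 0"
  shows "\<exists>p q r s. p * s - q * r = 1 \<and>
    (p *\<^sub>R A + q *\<^sub>R B) \<bullet> (r *\<^sub>R A + s *\<^sub>R B) = 0 \<and>
    norm (p *\<^sub>R A + q *\<^sub>R B) = norm (r *\<^sub>R A + s *\<^sub>R B)"
proof -
  obtain a b where ab: "a\<^sup>2 + b\<^sup>2 = 1" and orth: "(a *\<^sub>R A + b *\<^sub>R B) \<bullet> (- b *\<^sub>R A + a *\<^sub>R B) = 0"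
    using exists_orthogonal_rotation by blast
  define X Y where "X = a *\<^sub>R A + b *\<^sub>R B" and "Y = - b *\<^sub>R A + a *\<^sub>R B"
  have "gram X Y = (a * a - b * - b)\<^sup>2 * gram A B"
    unfolding X_def Y_def by (rule gram_linear_combination)
  also have "a * a - b * - b = 1" using ab by (simp add: power2_eq_square)
  finally have "gram X Y > 0" using assms by simp
  then have XY: "norm X > 0" "norm Y > 0" by (auto simp: gram_def)
  define l where "l = sqrt (norm Y / norm X)"
  have l: "l > 0" "l * l = norm Y / norm X" using XY by (simp_all add: l_def)
  show ?thesis
  proof (intro exI conjI)
    show "(l * a) * (inverse l * a) - (l * b) * (inverse l * - b) = 1"
      using l(1) ab by (simp add: power2_eq_square field_simps)
    have X: "(l * a) *\<^sub>R A + (l * b) *\<^sub>R B = l *\<^sub>R X"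
      and Y: "(inverse l * - b) *\<^sub>R A + (inverse l * a) *\<^sub>R B = inverse l *\<^sub>R Y"
      by (simp_all add: X_def Y_def scaleR_diff_right scaleR_add_right)
    show "((l * a) *\<^sub>R A + (l * b) *\<^sub>R B) \<bullet> ((inverse l * - b) *\<^sub>R A + (inverse l * a) *\<^sub>R B) = 0"
      unfolding X Y using orth by (simp add: X_def Y_def)
    have "l * norm X * l = norm Y" using l(2) XY by (simp add: field_simps)
    then show "norm ((l * a) *\<^sub>R A + (l * b) *\<^sub>R B) = norm ((inverse l * - b) *\<^sub>R A + (inverse l * a) *\<^sub>R B)"
      unfolding X Y using l(1) by (simp add: field_simps)
  qed
qed

text \<open>
  The pair \<open>(N A N\<^sup>T, N B N\<^sup>T)\<close> together with a conformal basis of its span. For such a basis the norm is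
  controlled by the area, which supplies the compactness needed for a minimizing sequence.
\<close>

lemma conformal_orbit_point:
  fixes A B :: "real^'n^'n"
  assumes sym: "transpose A = A" "transpose B = B"
    and deg: "\<And>a' b'. degenerate_at A B a b a' b'" and ab: "a\<^sup>2 + b\<^sup>2 = 1"
    and low: "\<And>M. det M = 1 \<Longrightarrow> g \<le> gram (congr M A) (congr M B)" and g: "g > 0"
    and N: "det N = 1" "gram (congr N A) (congr N B) \<le> h"
  shows "\<exists>X Y :: real^'n^'n. \<exists>a b. transpose X = X \<and> transpose Y = Y \<and> X \<bullet> Y = 0 \<and> norm X = norm Y \<and>
    gram X Y \<le> h \<and> (\<forall>M. det M = 1 \<longrightarrow> g \<le> gram (congr M X) (congr M Y)) \<and>
    a\<^sup>2 + b\<^sup>2 = 1 \<and> (\<forall>a' b'. degenerate_at X Y a b a' b')"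
proof -
  have "gram (congr N A) (congr N B) > 0" using low[OF N(1)] g by simp
  then obtain p q r s where det: "p * s - q * r = 1"
    and orth: "(p *\<^sub>R congr N A + q *\<^sub>R congr N B) \<bullet> (r *\<^sub>R congr N A + s *\<^sub>R congr N B) = 0"
    and norm: "norm (p *\<^sub>R congr N A + q *\<^sub>R congr N B) = norm (r *\<^sub>R congr N A + s *\<^sub>R congr N B)"
    using exists_conformal_basis by blast
  define X where "X = p *\<^sub>R congr N A + q *\<^sub>R congr N B"
  define Y where "Y = r *\<^sub>R congr N A + s *\<^sub>R congr N B"
  have symN: "transpose (congr N Z) = congr N Z" if "transpose Z = Z" for Z
    using that by (simp add: congr_def matrix_transpose_mul matrix_mul_assoc)
  have "transpose X = X" "transpose Y = Y"
    by (simp_all add: X_def Y_def transpose_add transpose_scaleR symN sym)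
  moreover have gram: "gram (congr M X) (congr M Y) = gram (congr (M ** N) A) (congr (M ** N) B)" for M
    using gram_linear_combination[of p "congr M (congr N A)" q "congr M (congr N B)" r s]
    by (simp add: X_def Y_def congr_add congr_scaleR det congr_congr)
  have "gram X Y \<le> h"
    using gram[of "mat 1"] N(2) by (simp add: congr_mat_1)
  moreover have "g \<le> gram (congr M X) (congr M Y)" if "det M = 1" for M
    unfolding gram by (rule low) (simp add: det_mul that N(1))
  moreover have "\<exists>a b. a\<^sup>2 + b\<^sup>2 = 1 \<and> (\<forall>a' b'. degenerate_at X Y a b a' b')"
    by (rule degenerate_at_basis_change[OF _ ab det X_def Y_def])
       (simp add: degenerate_at_congr[OF N(1)] deg)
  ultimately show ?thesis using orth norm unfolding X_def[symmetric] Y_def[symmetric] by blast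
qed

text \<open>
  The method of Kempf and Ness. If the areas in the orbit were bounded away from zero, then a
  minimizing sequence, written in conformal bases, would converge to a pair that is of minimal area in
  its own orbit and still degenerate. At such a minimum \<open>A\<^sup>2 + B\<^sup>2\<close> is scalar, and then some coefficient of
  index at most \<open>d / 2\<close> is non-zero in every conformal basis of the pencil, a contradiction.
\<close>

lemma degenerate_imp_small_gram:
  fixes A B :: "real^'n^'n"
  assumes sym: "transpose A = A" "transpose B = B"
    and ab: "a\<^sup>2 + b\<^sup>2 = 1" and deg: "\<And>a' b'. degenerate_at A B a b a' b'"
    and \<epsilon>: "\<epsilon> > 0"
  shows "\<exists>M. det M = 1 \<and> gram (congr M A) (congr M B) < \<epsilon>"
proof (rule ccontr)
  assume no: "\<nexists>M. det M = 1 \<and> gram (congr M A) (congr M B) < \<epsilon>"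
  define V where "V = (\<lambda>M. gram (congr M A) (congr M B)) ` {M. det M = 1}"
  define g where "g = Inf V"
  have ne: "V \<noteq> {}" unfolding V_def by (auto intro!: exI[of _ "mat 1"])
  have "\<epsilon> \<le> v" if "v \<in> V" for v using that no unfolding V_def by force
  then have "\<epsilon> \<le> g" unfolding g_def using ne by (intro cInf_greatest)
  with \<epsilon> have g: "g > 0" by simp
  have bdd: "bdd_below V" by (auto simp: V_def gram_nonneg intro!: bdd_belowI[of _ 0])
  then have low: "g \<le> gram (congr M A) (congr M B)" if "det M = 1" for M
    unfolding g_def using that by (intro cInf_lower) (auto simp: V_def)
  have "\<exists>X Y :: real^'n^'n. \<exists>a b. transpose X = X \<and> transpose Y = Y \<and> X \<bullet> Y = 0 \<and> norm X = norm Y \<and>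
    gram X Y \<le> g + inverse (real (Suc n)) \<and> (\<forall>M. det M = 1 \<longrightarrow> g \<le> gram (congr M X) (congr M Y)) \<and>
    a\<^sup>2 + b\<^sup>2 = 1 \<and> (\<forall>a' b'. degenerate_at X Y a b a' b')" for n
  proof -
    have "Inf V < g + inverse (real (Suc n))" unfolding g_def by simp
    then obtain N where "det N = 1" "gram (congr N A) (congr N B) < g + inverse (real (Suc n))"
      using cInf_less_iff[OF ne bdd] by (auto simp: V_def)
    then show ?thesis using conformal_orbit_point[OF sym deg ab low g] by (meson less_imp_le)
  qed
  then obtain X Y :: "nat \<Rightarrow> real^'n^'n" and a b where
        symn: "\<And>n. transpose (X n) = X n" "\<And>n. transpose (Y n) = Y n"
    and orth: "\<And>n. X n \<bullet> Y n = 0" and norm: "\<And>n. norm (X n) = norm (Y n)"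
    and upper: "\<And>n. gram (X n) (Y n) \<le> g + inverse (real (Suc n))"
    and lower: "\<And>n M. det M = 1 \<Longrightarrow> g \<le> gram (congr M (X n)) (congr M (Y n))"
    and abn: "\<And>n. (a n)\<^sup>2 + (b n)\<^sup>2 = 1" and degn: "\<And>n a' b'. degenerate_at (X n) (Y n) (a n) (b n) a' b'"
    by metis
  (* In a conformal basis the squared area is the fourth power of the common norm, so the
     sequence is bounded. *)
  have norm4: "norm (X n) ^ 4 \<le> g + 1" for n
  proof -
    have "norm (X n) ^ 4 = gram (X n) (Y n)"
      using orth norm by (simp add: gram_def power2_norm_eq_inner[symmetric] flip: power_add)
    also have "\<dots> \<le> g + 1"
      using upper[of n] by (rule order_trans) (simp add: inverse_le_1_iff)
    finally show ?thesis .
  qed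
  have normX: "norm (X n) \<le> g + 1" for n
  proof (cases "norm (X n) \<le> 1")
    case True then show ?thesis using g by simp
  next
    case False
    then have "norm (X n) ^ 1 \<le> norm (X n) ^ 4" by (intro power_increasing) auto
    then show ?thesis using norm4[of n] by simp
  qed
  have "norm ((X n, Y n), (a n, b n)) \<le> (g + 1) + (g + 1) + 1" for n
  proof -
    have "norm (a n, b n) = 1" using abn[of n] by (simp add: norm_prod_def)
    then show ?thesis
      using norm_Pair_le[of "(X n, Y n)" "(a n, b n)"] norm_Pair_le[of "X n" "Y n"] normX[of n] norm[of n]
      by simp
  qed
  then have "bounded (range (\<lambda>n. ((X n, Y n), (a n, b n))))" by (auto simp: bounded_iff)
  then obtain l \<sigma> where \<sigma>: "strict_mono (\<sigma> :: nat \<Rightarrow> nat)"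
    and lim: "((\<lambda>n. ((X n, Y n), (a n, b n))) \<circ> \<sigma>) \<longlonglongrightarrow> l"
    using bounded_imp_convergent_subsequence by blast
  obtain X' Y' a' b' where l: "l = ((X', Y'), (a', b'))" by (metis surj_pair)
  have X: "(\<lambda>n. X (\<sigma> n)) \<longlonglongrightarrow> X'" and Y: "(\<lambda>n. Y (\<sigma> n)) \<longlonglongrightarrow> Y'"
    and a: "(\<lambda>n. a (\<sigma> n)) \<longlonglongrightarrow> a'" and b: "(\<lambda>n. b (\<sigma> n)) \<longlonglongrightarrow> b'"
    using tendsto_fst[OF tendsto_fst[OF lim]] tendsto_snd[OF tendsto_fst[OF lim]]
      tendsto_fst[OF tendsto_snd[OF lim]] tendsto_snd[OF tendsto_snd[OF lim]]
    by (simp_all add: l o_def)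
  have "linear (transpose :: real^'n^'n \<Rightarrow> _)" by (rule linearI) (auto simp: transpose_add transpose_scaleR)
  then have tr: "(\<lambda>n. transpose (Z n)) \<longlonglongrightarrow> transpose Z'" if "Z \<longlonglongrightarrow> Z'" for Z and Z' :: "real^'n^'n"
    using that by (simp add: bounded_linear.tendsto linear_conv_bounded_linear)
  have sym': "transpose X' = X'" "transpose Y' = Y'"
    using LIMSEQ_unique[OF tr[OF X]] LIMSEQ_unique[OF tr[OF Y]] X Y by (simp_all add: symn)
  have tendsto_gram: "(\<lambda>n. gram (U n) (W n)) \<longlonglongrightarrow> gram U' W'"
    if "U \<longlonglongrightarrow> U'" "W \<longlonglongrightarrow> W'" for U W and U' W' :: "real^'n^'n"
    unfolding gram_def by (intro tendsto_intros that)
  have orth': "X' \<bullet> Y' = 0"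
    using LIMSEQ_unique[OF tendsto_inner[OF X Y]] by (simp add: orth)
  have norm': "norm X' = norm Y'"
    using LIMSEQ_unique[OF tendsto_norm[OF X]] tendsto_norm[OF Y] by (simp add: norm)
  have min: "g \<le> gram (congr M X') (congr M Y')" if "det M = 1" for M
    using lower[OF that]
    by (intro LIMSEQ_le_const[OF tendsto_gram[OF tendsto_congr[OF X] tendsto_congr[OF Y]]]) auto
  have "gram X' Y' \<le> g + 0"
  proof (rule LIMSEQ_le[OF tendsto_gram[OF X Y]])
    show "(\<lambda>n. g + inverse (real (Suc (\<sigma> n)))) \<longlonglongrightarrow> g + 0"
      using LIMSEQ_subseq_LIMSEQ[OF LIMSEQ_inverse_real_of_nat \<sigma>] by (intro tendsto_intros) (simp add: o_def)
  qed (use upper in blast)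
  moreover have "g \<le> gram X' Y'" using min[of "mat 1"] by (simp add: congr_mat_1)
  ultimately have gram': "gram X' Y' = g" by simp
  have ab': "a'\<^sup>2 + b'\<^sup>2 = 1"
    using LIMSEQ_unique[OF tendsto_add[OF tendsto_power[OF a, of 2] tendsto_power[OF b, of 2]]] by (simp add: abn)
  have deg': "degenerate_at X' Y' a' b' (- b') a'"
    unfolding degenerate_at_def
  proof (intro allI impI)
    fix j assume j: "j \<le> CARD('n) div 2"
    let ?c = "\<lambda>X Y a b. coeff (line_det (a *\<^sub>R X + b *\<^sub>R Y) (- b *\<^sub>R X + a *\<^sub>R Y)) j"
    have "(\<lambda>n. ?c (X (\<sigma> n)) (Y (\<sigma> n)) (a (\<sigma> n)) (b (\<sigma> n))) \<longlonglongrightarrow> ?c X' Y' a' b'"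
      by (intro coeff_line_det_tendsto tendsto_intros X Y a b)
    moreover have "?c (X (\<sigma> n)) (Y (\<sigma> n)) (a (\<sigma> n)) (b (\<sigma> n)) = 0" for n
      using degn j unfolding degenerate_at_def by blast
    ultimately show "?c X' Y' a' b' = 0" by (simp add: LIMSEQ_const_iff)
  qed
  (* The rotated basis in which the degenerate point becomes P; Q is the transversal direction. *)
  define P where "P = a' *\<^sub>R X' + b' *\<^sub>R Y'"
  define Q where "Q = - b' *\<^sub>R X' + a' *\<^sub>R Y'"
  have det: "a' * a' - b' * - b' = 1" using ab' by (simp add: power2_eq_square)
  have sq: "X' \<bullet> X' = Y' \<bullet> Y'" using norm' by (simp add: norm_eq)
  have gramPQ: "gram (congr M P) (congr M Q) = gram (congr M X') (congr M Y')" for M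
    using gram_linear_combination[of a' "congr M X'" b' "congr M Y'" "- b'" a'] det
    by (simp only: P_def Q_def congr_add congr_scaleR) simp
  have c: "Y' \<bullet> X' = 0" using orth' by (simp add: inner_commute)
  have PP: "P \<bullet> P = X' \<bullet> X'" and QQ: "Q \<bullet> Q = X' \<bullet> X'"
    unfolding P_def Q_def inner_simps orth' c sq[symmetric] using ab' by algebra+
  have QP: "Q \<bullet> P = 0"
    unfolding P_def Q_def inner_simps orth' c sq[symmetric] by simp
  have symPQ: "transpose Q = Q" "transpose P = P"
    by (simp_all only: P_def Q_def transpose_add transpose_scaleR sym')
  have "\<exists>c > 0. Q ** Q + P ** P = c *\<^sub>R mat 1"
  proof (rule gram_minimum_scalar[OF symPQ QP])
    show "Q \<bullet> Q = P \<bullet> P" by (simp add: PP QQ)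
    have "X' \<noteq> 0" using gram' g by (auto simp: gram_def)
    then show "Q \<bullet> Q > 0" by (simp add: QQ)
    have swap: "gram U W = gram W U" for U W :: "real^'n^'n" by (simp add: gram_def inner_commute mult.commute)
    show "gram Q P \<le> gram (congr M Q) (congr M P)" if "det M = 1" for M
      using min[OF that] gramPQ[of M] gramPQ[of "mat 1"] gram' by (simp add: swap[of Q] swap[of "congr M Q"] congr_mat_1)
  qed
  then obtain c where "c > 0" "Q ** Q + P ** P = c *\<^sub>R mat 1" by blast
  then obtain k where "k \<le> CARD('n) div 2" "coeff (line_det P Q) k \<noteq> 0"
    using scalar_imp_nonzero_coefficient[OF symPQ] PP QQ by metis
  then show False using deg' unfolding degenerate_at_def P_def Q_def by blast
qed

section \<open>The affine density\<close>

lemma permutes_map_sum: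
  fixes p :: "'a::finite \<Rightarrow> 'a" and q :: "'b::finite \<Rightarrow> 'b"
  assumes "p permutes UNIV" "q permutes UNIV"
  shows "map_sum p q permutes UNIV" and "sign (map_sum p q) = sign p * sign q"
proof -
  have l: "map_permutation UNIV Inl p = (map_sum p id :: 'a + 'b \<Rightarrow> _)"
    by (rule ext, rename_tac x, case_tac x) (auto simp: map_permutation_def restrict_id_def)
  have r: "map_permutation UNIV Inr q = (map_sum id q :: 'a + 'b \<Rightarrow> _)"
    by (rule ext, rename_tac x, case_tac x) (auto simp: map_permutation_def restrict_id_def)
  have c: "map_sum p q = (map_sum p id :: 'a + 'b \<Rightarrow> _) \<circ> map_sum id q"
    by (rule ext, rename_tac x, case_tac x) auto
  have pl: "(map_sum p id :: 'a + 'b \<Rightarrow> _) permutes range Inl"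
    unfolding l[symmetric] using assms by (intro map_permutation_permutes) (auto simp: bij_betw_def)
  have pr: "(map_sum id q :: 'a + 'b \<Rightarrow> _) permutes range Inr"
    unfolding r[symmetric] using assms by (intro map_permutation_permutes) (auto simp: bij_betw_def)
  show "map_sum p q permutes UNIV"
    unfolding c using pl pr by (intro permutes_compose) (auto intro: permutes_subset)
  have "sign (map_sum p id :: 'a + 'b \<Rightarrow> _) = sign p" "sign (map_sum id q :: 'a + 'b \<Rightarrow> _) = sign q"
    unfolding l[symmetric] r[symmetric] using assms by (simp_all add: sign_map_permutation)
  moreover have "sign (map_sum p q) = sign (map_sum p id :: 'a + 'b \<Rightarrow> _) * sign (map_sum id q :: 'a + 'b \<Rightarrow> _)"
    unfolding c using pl pr by (intro sign_compose) (auto simp: permutation_permutes)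
  ultimately show "sign (map_sum p q) = sign p * sign q" by simp
qed

lemma permutes_sum_split:
  fixes \<pi> :: "'a::finite + 'b::finite \<Rightarrow> 'a + 'b"
  assumes \<pi>: "\<pi> permutes UNIV" and l: "\<And>i. \<pi> (Inl i) \<in> range Inl"
  shows "\<exists>p q. p permutes UNIV \<and> q permutes UNIV \<and> \<pi> = map_sum p q"
proof -
  have inj: "inj \<pi>" using \<pi> by (rule permutes_inj)
  have "\<pi> ` range Inl = range Inl"
  proof (rule card_subset_eq)
    show "card (\<pi> ` range Inl) = card (range Inl :: ('a + 'b) set)"
      by (rule card_image) (rule inj_on_subset[OF inj], simp)
  qed (use l in auto)
  then have surj: "x \<in> \<pi> ` range Inl" if "x \<in> range Inl" for x using that by simp
  have r: "\<pi> (Inr j) \<in> range Inr" for j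
  proof (cases "\<pi> (Inr j)")
    case (Inl a)
    then obtain i where "\<pi> (Inr j) = \<pi> (Inl i)" using surj[of "Inl a"] by auto
    then show ?thesis using injD[OF inj] by blast
  qed simp
  define p where "p i = projl (\<pi> (Inl i))" for i
  define q where "q j = projr (\<pi> (Inr j))" for j
  have p: "\<pi> (Inl i) = Inl (p i)" for i using l[of i] by (auto simp: p_def)
  have q: "\<pi> (Inr j) = Inr (q j)" for j using r[of j] by (auto simp: q_def)
  have "inj p" "inj q" using inj p q by (metis injD injI sum.inject)+
  then have "p permutes UNIV" "q permutes UNIV"
    by (auto intro!: bij_imp_permutes simp: bij_def finite_UNIV_inj_surj)
  moreover have "\<pi> = map_sum p q"
    by (rule ext, rename_tac x, case_tac x) (auto simp: p q)
  ultimately show ?thesis by blast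
qed

text \<open>
  In the Leibniz expansion only those permutations survive that preserve the two blocks.
\<close>

lemma det_block_triangular:
  fixes N :: "'c::comm_ring_1 ^ ('a::finite + 'b::finite) ^ ('a + 'b)"
  assumes zero: "\<And>r m. N $ Inl r $ Inr m = 0"
  shows "det N = det (\<chi> r c. N $ Inl r $ Inl c) * det (\<chi> r c. N $ Inr r $ Inr c)"
proof -
  define t where "t \<pi> = of_int (sign \<pi>) * (\<Prod>i\<in>UNIV. N $ i $ \<pi> i)" for \<pi>
  define T where "T = (\<lambda>(p, q). map_sum p q :: 'a + 'b \<Rightarrow> _) ` ({p. p permutes UNIV} \<times> {q. q permutes UNIV})"
  have inj: "inj_on (\<lambda>(p, q). map_sum p q :: 'a + 'b \<Rightarrow> 'a + 'b) S" for S
  proof (rule inj_onI, clarify)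
    fix p p' :: "'a \<Rightarrow> 'a" and q q' :: "'b \<Rightarrow> 'b" assume eq: "map_sum p q = map_sum p' q'"
    show "p = p' \<and> q = q'"
      using fun_cong[OF eq, of "Inl _"] fun_cong[OF eq, of "Inr _"] by auto
  qed
  have "det N = (\<Sum>\<pi> | \<pi> permutes UNIV. t \<pi>)" by (simp add: det_def t_def)
  also have "\<dots> = (\<Sum>\<pi>\<in>T. t \<pi>)"
  proof (rule sum.mono_neutral_right)
    show "T \<subseteq> {\<pi>. \<pi> permutes UNIV}" by (auto simp: T_def permutes_map_sum)
    show "\<forall>\<pi>\<in>{\<pi>. \<pi> permutes UNIV} - T. t \<pi> = 0"
    proof
      fix \<pi> assume "\<pi> \<in> {\<pi>. \<pi> permutes UNIV} - T"
      then obtain i where "\<pi> (Inl i) \<notin> range Inl"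
        using permutes_sum_split[of \<pi>] by (auto simp: T_def)
      then obtain m where "\<pi> (Inl i) = Inr m" by (cases "\<pi> (Inl i)") auto
      then have "(\<Prod>i\<in>UNIV. N $ i $ \<pi> i) = 0"
        by (intro prod_zero bexI[of _ "Inl i"]) (auto simp: zero)
      then show "t \<pi> = 0" by (simp add: t_def)
    qed
  qed simp
  also have "\<dots> = (\<Sum>(p, q)\<in>{p. p permutes UNIV} \<times> {q. q permutes UNIV}. t (map_sum p q))"
    unfolding T_def by (subst sum.reindex[OF inj]) (simp add: case_prod_unfold o_def)
  also have "\<dots> = (\<Sum>(p, q)\<in>{p. p permutes UNIV} \<times> {q. q permutes UNIV}.
      (of_int (sign p) * (\<Prod>i\<in>UNIV. N $ Inl i $ Inl (p i))) * (of_int (sign q) * (\<Prod>i\<in>UNIV. N $ Inr i $ Inr (q i))))"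
  proof (rule sum.cong, simp, clarify)
    fix p :: "'a \<Rightarrow> 'a" and q :: "'b \<Rightarrow> 'b" assume "p permutes UNIV" "q permutes UNIV"
    moreover have "(\<Prod>i\<in>UNIV. N $ i $ map_sum p q i) =
       (\<Prod>i\<in>UNIV. N $ Inl i $ Inl (p i)) * (\<Prod>i\<in>UNIV. N $ Inr i $ Inr (q i))"
      unfolding UNIV_Plus_UNIV[symmetric] by (subst prod.Plus) auto
    ultimately show "t (map_sum p q) =
      (of_int (sign p) * (\<Prod>i\<in>UNIV. N $ Inl i $ Inl (p i))) * (of_int (sign q) * (\<Prod>i\<in>UNIV. N $ Inr i $ Inr (q i)))"
      by (simp add: t_def permutes_map_sum mult_ac)
  qed
  also have "\<dots> = det (\<chi> r c. N $ Inl r $ Inl c) * det (\<chi> r c. N $ Inr r $ Inr c)"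
    unfolding det_def by (simp add: sum_product sum.cartesian_product)
  finally show ?thesis .
qed

lemma has_derivative_vec:
  fixes f :: "'a::real_normed_vector \<Rightarrow> real^'m"
  assumes "\<And>i. ((\<lambda>x. f x $ i) has_derivative (\<lambda>h. f' h $ i)) (at x within S)"
  shows "(f has_derivative f') (at x within S)"
proof -
  have "((\<lambda>x. \<Sum>i\<in>UNIV. f x $ i *\<^sub>R (axis i 1 :: real^'m)) has_derivative (\<lambda>h. \<Sum>i\<in>UNIV. f' h $ i *\<^sub>R (axis i 1 :: real^'m))) (at x within S)"
    by (intro has_derivative_sum has_derivative_scaleR_left assms)
  moreover have "(\<Sum>i\<in>UNIV. y $ i *\<^sub>R axis i 1) = y" for y :: "real^'m"
    using basis_expansion[of y] unfolding scalar_mult_eq_scaleR .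
  ultimately show ?thesis by simp
qed

lemma partial_eq: "(f has_derivative f') (at x) \<Longrightarrow> partial k f x = f' (axis k 1)"
  by (simp add: partial_def frechet_derivative_at[symmetric])

lemma quadratic_form_imp_matrix:
  fixes Q :: "real^'n \<Rightarrow> real"
  assumes "quadratic_form Q"
  shows "\<exists>H. transpose H = H \<and> (\<forall>x. Q x = (x \<bullet> (H *v x)) / 2)"
proof -
  obtain B where B: "bilinear B" and Q: "\<And>x. Q x = B x x"
    using assms by (auto simp: quadratic_form_def)
  define H :: "real^'n^'n" where "H = (\<chi> i j. B (axis i 1) (axis j 1) + B (axis j 1) (axis i 1))"
  have "B x x = (\<Sum>i\<in>UNIV. \<Sum>j\<in>UNIV. x $ i * x $ j * B (axis i 1) (axis j 1))" for x
  proof -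
    have "B x x = B (\<Sum>i\<in>UNIV. x $ i *\<^sub>R axis i 1) (\<Sum>i\<in>UNIV. x $ i *\<^sub>R axis i 1)"
      by (simp add: basis_expansion flip: scalar_mult_eq_scaleR)
    also have "\<dots> = (\<Sum>i\<in>UNIV. \<Sum>j\<in>UNIV. x $ i * x $ j * B (axis i 1) (axis j 1))"
      by (simp add: bilinear_sum[OF B] bilinear_lmul[OF B] bilinear_rmul[OF B] sum.cartesian_product mult_ac)
    finally show ?thesis .
  qed
  note BB = this
  have "x \<bullet> (H *v x) = 2 * B x x" for x
  proof -
    have "x \<bullet> (H *v x) = (\<Sum>i\<in>UNIV. \<Sum>j\<in>UNIV. x $ i * x $ j * B (axis i 1) (axis j 1)) +
       (\<Sum>i\<in>UNIV. \<Sum>j\<in>UNIV. x $ i * x $ j * B (axis j 1) (axis i 1))"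
      by (simp add: inner_vec_def matrix_vector_mult_def H_def sum_distrib_left algebra_simps flip: sum.distrib)
    also have "(\<Sum>i\<in>UNIV. \<Sum>j\<in>UNIV. x $ i * x $ j * B (axis j 1) (axis i 1)) =
       (\<Sum>i\<in>UNIV. \<Sum>j\<in>UNIV. x $ i * x $ j * B (axis i 1) (axis j 1))"
      by (subst sum.swap) (simp add: mult_ac)
    finally show ?thesis by (simp add: BB)
  qed
  then show ?thesis
    by (intro exI[of _ H]) (auto simp: Q H_def transpose_def vec_eq_iff)
qed

lemma has_derivative_quadratic:
  fixes H :: "real^'n^'n"
  assumes sym: "transpose H = H"
  shows "((\<lambda>x. (x \<bullet> (H *v x)) / 2) has_derivative (\<lambda>h. (H *v x) \<bullet> h)) (at x)"
proof -
  have lin: "((\<lambda>x. H *v x) has_derivative (\<lambda>h. H *v h)) (at x)"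
    by (rule bounded_linear.has_derivative[OF matrix_vector_mul_bounded_linear has_derivative_ident])
  have adj: "x \<bullet> (H *v h) = (H *v x) \<bullet> h" for h
    by (metis dot_lmul_matrix sym transpose_matrix_vector)
  have "((\<lambda>x. (x \<bullet> (H *v x)) / 2) has_derivative (\<lambda>h. (x \<bullet> (H *v h) + h \<bullet> (H *v x)) / 2)) (at x)"
    by (rule bounded_linear.has_derivative[OF bounded_linear_divide has_derivative_inner[OF has_derivative_ident lin]])
  then show ?thesis unfolding adj inner_commute[of _ "H *v x"] by simp
qed

lemma partial_quadratic:
  fixes H :: "real^'n^'n"
  assumes "transpose H = H"
  shows "partial k (\<lambda>x. (x \<bullet> (H *v x)) / 2) x = (H *v x) $ k"
  by (simp add: partial_eq[OF has_derivative_quadratic[OF assms]] inner_axis)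

lemma hessian_quadratic:
  fixes H :: "real^'n^'n"
  assumes "transpose H = H"
  shows "hessian (\<lambda>x. (x \<bullet> (H *v x)) / 2) x = H"
proof -
  have "((\<lambda>x. (H *v x) $ j) has_derivative (\<lambda>h. (H *v h) $ j)) (at x)" for j
    by (intro bounded_linear.has_derivative[OF bounded_linear_vec_nth]
        bounded_linear.has_derivative[OF matrix_vector_mul_bounded_linear] has_derivative_ident)
  from partial_eq[OF this] have "partial i (\<lambda>x. (H *v x) $ j) x = H $ j $ i" for i j
    by (simp add: matrix_vector_mult_basis column_def)
  moreover have "H $ j $ i = H $ i $ j" for i j
    using assms by (metis transpose_def vec_lambda_beta)
  ultimately show ?thesis
    by (simp add: hessian_def partial_quadratic[OF assms, abs_def] vec_eq_iff)
qed

text \<open>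
  The frame determinants of the surface: in the first derivatives the coordinates of \<open>\<real>\<^sup>d\<close> carry the rows
  of \<open>M\<close>, the second derivatives have no such coordinates, and in the last two coordinates they are the
  entries of \<open>M H\<^sub>1 M\<^sup>T\<close> and \<open>M H\<^sub>2 M\<^sup>T\<close>. So each determinant is block triangular.
\<close>

context
  fixes H1 H2 :: "real^'n^'n" and Q1 Q2 :: "real^'n \<Rightarrow> real"
  assumes sym: "transpose H1 = H1" "transpose H2 = H2"
    and Q1: "Q1 = (\<lambda>x. (x \<bullet> (H1 *v x)) / 2)" and Q2: "Q2 = (\<lambda>x. (x \<bullet> (H2 *v x)) / 2)"
begin

lemma vfield_graph_map:
  "vfield M i (graph_map Q1 Q2) x =
    (\<chi> r. case r of Inl l \<Rightarrow> M $ i $ l | Inr j \<Rightarrow> if j = 1 then (M *v (H1 *v x)) $ i else (M *v (H2 *v x)) $ i)"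
proof -
  have "(graph_map Q1 Q2 has_derivative (\<lambda>h. \<chi> k. case k of Inl i \<Rightarrow> h $ i | Inr j \<Rightarrow>
      if j = 1 then (H1 *v x) \<bullet> h else (H2 *v x) \<bullet> h)) (at x)"
  proof (rule has_derivative_vec)
    fix k :: "'n + 2"
    show "((\<lambda>x. graph_map Q1 Q2 x $ k) has_derivative (\<lambda>h. (\<chi> k. case k of Inl i \<Rightarrow> h $ i | Inr j \<Rightarrow>
      if j = 1 then (H1 *v x) \<bullet> h else (H2 *v x) \<bullet> h) $ k)) (at x)"
    proof (cases k)
      case (Inl i)
      show ?thesis
        unfolding Inl graph_map_def vec_lambda_beta sum.case
        by (rule bounded_linear.has_derivative[OF bounded_linear_vec_nth has_derivative_ident])
    next
      case (Inr b)
      show ?thesis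
      proof (cases "b = 1")
        case True
        show ?thesis
          unfolding Inr graph_map_def vec_lambda_beta sum.case if_P[OF True] Q1
          by (rule has_derivative_quadratic[OF sym(1)])
      next
        case False
        show ?thesis
          unfolding Inr graph_map_def vec_lambda_beta sum.case if_not_P[OF False] Q2
          by (rule has_derivative_quadratic[OF sym(2)])
      qed
    qed
  qed
  from partial_eq[OF this] have "partial k (graph_map Q1 Q2) x $ r =
     (case r of Inl i \<Rightarrow> axis k 1 $ i | Inr j \<Rightarrow> if j = 1 then (H1 *v x) $ k else (H2 *v x) $ k)" for k r
    by (auto simp: inner_axis split: sum.split)
  then show ?thesis
    by (auto simp: vfield_def vec_eq_iff matrix_vector_mult_def[of M] axis_def if_distrib[of "\<lambda>x. _ * x"]
        split: sum.split cong: if_cong)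
qed

lemma vfield_vfield_graph_map:
  "vfield M i (vfield M j (graph_map Q1 Q2)) x =
    (\<chi> r. case r of Inl l \<Rightarrow> 0 | Inr m \<Rightarrow> if m = 1 then congr M H1 $ j $ i else congr M H2 $ j $ i)"
proof -
  let ?f = "\<lambda>x. \<chi> r. case r of Inl l \<Rightarrow> M $ j $ l | Inr (m :: 2) \<Rightarrow> if m = 1 then (M *v (H1 *v x)) $ j else (M *v (H2 *v x)) $ j"
  have lin: "((\<lambda>x. (M *v (H *v x)) $ j) has_derivative (\<lambda>h. (M *v (H *v h)) $ j)) (at x)" for H :: "real^'n^'n"
    by (intro bounded_linear.has_derivative[OF bounded_linear_vec_nth]
        bounded_linear.has_derivative[OF matrix_vector_mul_bounded_linear] has_derivative_ident)
  have "(?f has_derivative (\<lambda>h. \<chi> r. case r of Inl l \<Rightarrow> 0 | Inr m \<Rightarrow>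
      if m = 1 then (M *v (H1 *v h)) $ j else (M *v (H2 *v h)) $ j)) (at x)"
  proof (rule has_derivative_vec)
    fix k :: "'n + 2"
    show "((\<lambda>x. ?f x $ k) has_derivative (\<lambda>h. (\<chi> r. case r of Inl l \<Rightarrow> 0 | Inr m \<Rightarrow>
      if m = 1 then (M *v (H1 *v h)) $ j else (M *v (H2 *v h)) $ j) $ k)) (at x)"
    proof (cases k)
      case (Inl i)
      show ?thesis unfolding Inl vec_lambda_beta sum.case by (rule has_derivative_const)
    next
      case (Inr b)
      show ?thesis
      proof (cases "b = 1")
        case True
        show ?thesis unfolding Inr vec_lambda_beta sum.case if_P[OF True] by (rule lin)
      next
        case False
        show ?thesis unfolding Inr vec_lambda_beta sum.case if_not_P[OF False] by (rule lin)
      qed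
    qed
  qed
  note partial_f = partial_eq[OF this]
  have "(M *v (H *v axis k 1)) $ j = (M ** H) $ j $ k" for H :: "real^'n^'n" and k
    using matrix_vector_mul_assoc[of M H "axis k 1"] matrix_vector_mult_basis[of "M ** H" k]
    by (simp only: column_def vec_lambda_beta)
  then have "partial k ?f x $ r =
     (case r of Inl i \<Rightarrow> 0 | Inr m \<Rightarrow> if m = 1 then (M ** H1) $ j $ k else (M ** H2) $ j $ k)" for k r
    unfolding partial_f vec_lambda_beta by (simp only:)
  then show ?thesis
    unfolding vfield_graph_map[abs_def]
    by (auto simp: vfield_def[of _ _ ?f] vec_eq_iff congr_def matrix_matrix_mult_def[of "M ** _"]
        transpose_def mult.commute split: sum.split)
qed

lemma frame_det_graph_map:
  "frame_det M (graph_map Q1 Q2) x i j1 j2 k1 k2 = det (\<chi> l. M $ i l) *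
    (congr M H1 $ j2 $ j1 * congr M H2 $ k2 $ k1 - congr M H1 $ k2 $ k1 * congr M H2 $ j2 $ j1)"
proof -
  have "det (\<chi> r c. M $ i c $ r) = det (\<chi> l. M $ i l)"
    by (subst det_transpose[symmetric]) (simp add: transpose_def)
  then show ?thesis
    unfolding frame_det_def vfield_vfield_graph_map vfield_graph_map
    by (subst det_block_triangular) (simp_all add: det_2)
qed

end

text \<open>
  The multi-indices that are not permutations repeat a row; the others only contribute a sign. Hence
  the sum over the multi-index is the factor \<open>d!\<close>.
\<close>

lemma det_rows_squared:
  fixes M :: "real^'n^'n"
  assumes "det M = 1"
  shows "(det (\<chi> l. M $ i l))\<^sup>2 = (if inj i then 1 else 0)"
proof (cases "inj i")
  case True
  then have "i permutes UNIV"
    by (auto intro!: bij_imp_permutes simp: bij_def finite_UNIV_inj_surj)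
  then have "det (\<chi> l. M $ i l) = of_int (sign i)" using assms by (simp add: det_permute_rows)
  then show ?thesis using True by (simp add: sign_def)
next
  case False
  then obtain a b where "a \<noteq> b" "i a = i b" by (auto simp: inj_def)
  then have "det (\<chi> l. M $ i l) = 0"
    by (intro det_identical_rows[of a b]) (auto simp: row_def)
  then show ?thesis using False by simp
qed

lemma lagrange_identity:
  fixes a b :: "'i \<Rightarrow> real"
  shows "(\<Sum>j\<in>I. \<Sum>k\<in>I. (a j * b k - a k * b j)\<^sup>2) =
     2 * ((\<Sum>j\<in>I. a j * a j) * (\<Sum>j\<in>I. b j * b j) - (\<Sum>j\<in>I. a j * b j)\<^sup>2)"
proof -
  have "(\<Sum>j\<in>I. \<Sum>k\<in>I. (a j * b k - a k * b j)\<^sup>2) =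
      (\<Sum>j\<in>I. \<Sum>k\<in>I. (a j * a j) * (b k * b k)) + (\<Sum>j\<in>I. \<Sum>k\<in>I. (b j * b j) * (a k * a k))
      - 2 * (\<Sum>j\<in>I. \<Sum>k\<in>I. (a j * b j) * (a k * b k))"
    unfolding sum_distrib_left sum.distrib[symmetric] sum_subtractf[symmetric]
    by (intro sum.cong refl) (simp add: power2_eq_square algebra_simps)
  then show ?thesis
    unfolding sum_product[symmetric] by (simp add: power2_eq_square)
qed

lemma sum_minors_eq_gram:
  fixes X Y :: "real^'n^'n"
  shows "(\<Sum>j1\<in>UNIV. \<Sum>j2\<in>UNIV. \<Sum>k1\<in>UNIV. \<Sum>k2\<in>UNIV.
      (X $ j2 $ j1 * Y $ k2 $ k1 - X $ k2 $ k1 * Y $ j2 $ j1)\<^sup>2) = 2 * gram X Y"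
proof -
  have inner: "U \<bullet> V = (\<Sum>p\<in>UNIV. U $ snd p $ fst p * V $ snd p $ fst p)" for U V :: "real^'n^'n"
    unfolding UNIV_Times_UNIV[symmetric]
  proof -
    have "U \<bullet> V = (\<Sum>i\<in>UNIV. \<Sum>j\<in>UNIV. U $ i $ j * V $ i $ j)" by (simp add: inner_vec_def)
    also have "\<dots> = (\<Sum>j\<in>UNIV. \<Sum>i\<in>UNIV. U $ i $ j * V $ i $ j)" by (rule sum.swap)
    finally show "U \<bullet> V = (\<Sum>p\<in>UNIV \<times> UNIV. U $ snd p $ fst p * V $ snd p $ fst p)"
      by (simp only: sum.cartesian_product case_prod_unfold)
  qed
  define g where "g p q = (X $ snd p $ fst p * Y $ snd q $ fst q - X $ snd q $ fst q * Y $ snd p $ fst p)\<^sup>2"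
    for p q :: "'n \<times> 'n"
  have pair: "(\<Sum>a\<in>UNIV. \<Sum>b\<in>UNIV. h (a, b)) = (\<Sum>p\<in>UNIV. h p)" for h :: "'n \<times> 'n \<Rightarrow> real"
    by (simp add: sum.cartesian_product)
  have "(\<Sum>j1\<in>UNIV. \<Sum>j2\<in>UNIV. \<Sum>k1\<in>UNIV. \<Sum>k2\<in>UNIV.
      (X $ j2 $ j1 * Y $ k2 $ k1 - X $ k2 $ k1 * Y $ j2 $ j1)\<^sup>2) =
    (\<Sum>j1\<in>UNIV. \<Sum>j2\<in>UNIV. \<Sum>k1\<in>UNIV. \<Sum>k2\<in>UNIV. g (j1, j2) (k1, k2))"
    by (simp add: g_def)
  also have "\<dots> = (\<Sum>p\<in>UNIV. \<Sum>q\<in>UNIV. g p q)"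
    unfolding pair[of "g _"] by (rule pair)
  also have "\<dots> = 2 * gram X Y"
    unfolding g_def gram_def inner by (rule lagrange_identity)
  finally show ?thesis .
qed

lemma affine_density_graph_map:
  fixes H1 H2 :: "real^'n^'n" and Q1 Q2 :: "real^'n \<Rightarrow> real"
  assumes sym: "transpose H1 = H1" "transpose H2 = H2"
    and Q: "Q1 = (\<lambda>x. (x \<bullet> (H1 *v x)) / 2)" "Q2 = (\<lambda>x. (x \<bullet> (H2 *v x)) / 2)"
  shows "affine_density (graph_map Q1 Q2) \<xi> =
    (INF M\<in>{M. det M = 1}. sqrt (real (card {i :: 'n \<Rightarrow> 'n. inj i}) * (2 * gram (congr M H1) (congr M H2))))
      powr (real CARD('n) / (real CARD('n) + 4))"
proof -
  have "(\<Sum>i\<in>(UNIV :: ('n \<Rightarrow> 'n) set). \<Sum>j1\<in>UNIV. \<Sum>j2\<in>UNIV. \<Sum>k1\<in>UNIV. \<Sum>k2\<in>UNIV.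
                \<bar>frame_det M (graph_map Q1 Q2) \<xi> i j1 j2 k1 k2\<bar>\<^sup>2) =
      real (card {i :: 'n \<Rightarrow> 'n. inj i}) * (2 * gram (congr M H1) (congr M H2))" if "det M = 1" for M
  proof -
    have "(\<Sum>i\<in>(UNIV :: ('n \<Rightarrow> 'n) set). \<Sum>j1\<in>UNIV. \<Sum>j2\<in>UNIV. \<Sum>k1\<in>UNIV. \<Sum>k2\<in>UNIV.
                \<bar>frame_det M (graph_map Q1 Q2) \<xi> i j1 j2 k1 k2\<bar>\<^sup>2) =
      (\<Sum>i\<in>(UNIV :: ('n \<Rightarrow> 'n) set). (if inj i then 1 else 0) * (2 * gram (congr M H1) (congr M H2)))"
      unfolding frame_det_graph_map[OF sym Q] power2_abs power_mult_distrib det_rows_squared[OF that]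
        sum_distrib_left[symmetric] sum_minors_eq_gram ..
    also have "\<dots> = (\<Sum>i\<in>(UNIV :: ('n \<Rightarrow> 'n) set). if inj i then 1 else 0) * (2 * gram (congr M H1) (congr M H2))"
      by (rule sum_distrib_right[symmetric])
    also have "(\<Sum>i\<in>(UNIV :: ('n \<Rightarrow> 'n) set). if inj i then 1 else 0) = real (card {i :: 'n \<Rightarrow> 'n. inj i})"
      by (simp add: sum.If_cases)
    finally show ?thesis .
  qed
  then show ?thesis
    unfolding affine_density_def by (intro arg_cong2[where f = "(powr)"] refl INF_cong) auto
qed

lemma INF_sqrt_gram_eq_0_iff:
  fixes A B :: "real^'n^'n"
  assumes k: "k > 0"
  shows "(INF M\<in>{M. det M = 1}. sqrt (k * (2 * gram (congr M A) (congr M B)))) = 0 \<longleftrightarrow>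
    (\<forall>\<epsilon>>0. \<exists>M. det M = 1 \<and> gram (congr M A) (congr M B) < \<epsilon>)"
proof -
  let ?f = "\<lambda>M. sqrt (k * (2 * gram (congr M A) (congr M B)))"
  let ?S = "{M :: real^'n^'n. det M = 1}"
  have ne: "?S \<noteq> {}" by (auto intro!: exI[of _ "mat 1"])
  have pos: "?f M \<ge> 0" for M using k by (simp add: gram_nonneg)
  then have bdd: "bdd_below (?f ` ?S)" by (auto intro!: bdd_belowI[of _ 0])
  have Inf: "(INF M\<in>?S. ?f M) \<ge> 0" using ne pos by (intro cINF_greatest)
  have less: "?f M < sqrt (k * (2 * \<epsilon>)) \<longleftrightarrow> gram (congr M A) (congr M B) < \<epsilon>" for M \<epsilon>
    using k by simp
  show ?thesis
  proof
    assume z: "(INF M\<in>?S. ?f M) = 0"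
    show "\<forall>\<epsilon>>0. \<exists>M. det M = 1 \<and> gram (congr M A) (congr M B) < \<epsilon>"
    proof (intro allI impI)
      fix \<epsilon> :: real assume "\<epsilon> > 0"
      then have "(INF M\<in>?S. ?f M) < sqrt (k * (2 * \<epsilon>))" unfolding z using k by simp
      then obtain M where "M \<in> ?S" "?f M < sqrt (k * (2 * \<epsilon>))"
        using cINF_less_iff[OF ne bdd] by blast
      then show "\<exists>M. det M = 1 \<and> gram (congr M A) (congr M B) < \<epsilon>" using less by blast
    qed
  next
    assume small: "\<forall>\<epsilon>>0. \<exists>M. det M = 1 \<and> gram (congr M A) (congr M B) < \<epsilon>"
    show "(INF M\<in>?S. ?f M) = 0"
    proof (rule ccontr)
      assume "(INF M\<in>?S. ?f M) \<noteq> 0"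
      with Inf have p: "(INF M\<in>?S. ?f M) > 0" by simp
      define \<epsilon> where "\<epsilon> = (INF M\<in>?S. ?f M)\<^sup>2 / (2 * k)"
      have "\<epsilon> > 0" using p k by (simp add: \<epsilon>_def)
      then obtain M where M: "det M = 1" "gram (congr M A) (congr M B) < \<epsilon>" using small by blast
      have "?f M < sqrt (k * (2 * \<epsilon>))" using M less by blast
      also have "\<dots> = (INF M\<in>?S. ?f M)" using p k by (simp add: \<epsilon>_def)
      also have "\<dots> \<le> ?f M" using M(1) by (intro cINF_lower bdd) simp
      finally show False by simp
    qed
  qed
qed

section \<open>The criterion\<close>

theorem theorem2:
  fixes Q1 Q2 :: "real^'n \<Rightarrow> real"
  assumes "CARD('n) \<ge> 2"
    and "quadratic_form Q1" and "quadratic_form Q2"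
  shows "well_curved Q1 Q2 \<longleftrightarrow>
    pencil_det (hessian Q1 0) (hessian Q2 0) \<noteq> 0 \<and>
    \<not> (\<exists>r. is_root r (pencil_det (hessian Q1 0) (hessian Q2 0)) \<and>
         real (root_mult r (pencil_det (hessian Q1 0) (hessian Q2 0))) > real CARD('n) / 2)"
proof -
  obtain A where A: "transpose A = A" and Q1: "Q1 = (\<lambda>x. (x \<bullet> (A *v x)) / 2)"
    using quadratic_form_imp_matrix[OF assms(2)] by (auto simp: fun_eq_iff)
  obtain B where B: "transpose B = B" and Q2: "Q2 = (\<lambda>x. (x \<bullet> (B *v x)) / 2)"
    using quadratic_form_imp_matrix[OF assms(3)] by (auto simp: fun_eq_iff)
  define k where "k = real (card {i :: 'n \<Rightarrow> 'n. inj i})"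
  have "card {i :: 'n \<Rightarrow> 'n. inj i} > 0"
    unfolding card_gt_0_iff using inj_on_id[of "UNIV :: 'n set"] by (auto simp del: inj_on_id)
  then have "k > 0" by (simp add: k_def)
  define I where "I = (INF M\<in>{M. det M = 1}. sqrt (k * (2 * gram (congr M A) (congr M B))))"
  have density: "affine_density (graph_map Q1 Q2) \<xi> = I powr (real CARD('n) / (real CARD('n) + 4))" for \<xi>
    unfolding I_def k_def by (rule affine_density_graph_map[OF A B Q1 Q2])
  have "well_curved Q1 Q2 \<longleftrightarrow> I \<noteq> 0"
  proof
    assume "well_curved Q1 Q2"
    then obtain c where "c \<noteq> 0" and c: "\<And>\<xi> :: real^'n. (\<forall>i. \<xi> $ i \<in> {-1..1}) \<Longrightarrow> affine_density (graph_map Q1 Q2) \<xi> = c"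
      unfolding well_curved_def by blast
    then show "I \<noteq> 0" using c[of 0] by (auto simp: density)
  next
    assume "I \<noteq> 0"
    then show "well_curved Q1 Q2"
      unfolding well_curved_def density
      by (intro exI[of _ "I powr (real CARD('n) / (real CARD('n) + 4))"]) simp
  qed
  also have "I \<noteq> 0 \<longleftrightarrow> \<not> (\<forall>\<epsilon>>0. \<exists>M. det M = 1 \<and> gram (congr M A) (congr M B) < \<epsilon>)"
    unfolding I_def INF_sqrt_gram_eq_0_iff[OF \<open>k > 0\<close>] ..
  also have "\<dots> \<longleftrightarrow> \<not> unstable_pencil A B"
    using small_gram_imp_degenerate[of A B] degenerate_imp_unstable[of _ _ A B]
      unstable_imp_degenerate[of A B] degenerate_imp_small_gram[OF A B] by metis
  finally show ?thesis
    unfolding unstable_pencil_def Q1 Q2 hessian_quadratic[OF A] hessian_quadratic[OF B] by blast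
qed

end
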